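(* Let $J\subset R=K[x_1,\dots,x_n]$ be a generic ideal of type $(n,d_1,\dots,d_n)$, let $\delta=d_1+\cdots+d_n-n$, and let $B_i$ denote the set of standard monomials of degree $i$ with respect to $J$. Let $i$ be an integer with $0\le i\le \frac{\delta}{2}$. Then $$B_{\delta-i}=x_n^{\delta-2i}B_i .$$
   Context: $K$ is an infinite field that is an extension of a base field $F$. The monomial order on $R$ is the graded reverse lexicographic order with $x_1>\cdots>x_n$. A generic ideal of type $(n,d_1,\dots,d_n)$ is an ideal of $R$ generated by homogeneous polynomials $f_1,\dots,f_n$ with $\deg f_i=d_i\ge1$, where each $f_i=\sum_\alpha c_{i,\alpha}x^\alpha$ is a sum over all monomials of degree $d_i$ and all the coefficients $c_{i,\alpha}\in K$ (for all $i,\alpha$ together) are algebraically independent over $F$. A monomial is standard with respect to $J$ if it is not in the initial ideal $\operatorname{in}(J)$. For a monomial $m$ and a set $T$ of monomials, $mT=\{mt : t\in T\}$. *)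

theory Defs
  imports Main "HOL-Library.Poly_Mapping"
begin

text \<open>
  Exponent vectors are finitely supported functions \<open>nat \<Rightarrow>\<^sub>0 nat\<close>, and polynomials are elements of the
  monoid algebra \<open>(nat \<Rightarrow>\<^sub>0 nat) \<Rightarrow>\<^sub>0 'k\<close>. This type has a variable \<open>x\<^sub>k\<close> for every \<open>k :: nat\<close>;
  the ring \<open>K[x\<^sub>1, \<dots>, x\<^sub>n]\<close> is the subring \<open>R n\<close> of polynomials in which only the indices
  \<open>1, \<dots>, n\<close> occur.
\<close>

definition mdeg :: "(nat \<Rightarrow>\<^sub>0 nat) \<Rightarrow> nat" where
  "mdeg \<alpha> = (\<Sum>k\<in>Poly_Mapping.keys \<alpha>. Poly_Mapping.lookup \<alpha> k)"

definition exponents :: "nat \<Rightarrow> nat \<Rightarrow> (nat \<Rightarrow>\<^sub>0 nat) set" where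
  "exponents n e = {\<alpha>. Poly_Mapping.keys \<alpha> \<subseteq> {1..n} \<and> mdeg \<alpha> = e}"

definition mono_of :: "(nat \<Rightarrow>\<^sub>0 nat) \<Rightarrow> (nat \<Rightarrow>\<^sub>0 nat) \<Rightarrow>\<^sub>0 'k::field" where
  "mono_of \<alpha> = Poly_Mapping.single \<alpha> 1"

definition var :: "nat \<Rightarrow> (nat \<Rightarrow>\<^sub>0 nat) \<Rightarrow>\<^sub>0 'k::field" where
  "var k = mono_of (Poly_Mapping.single k 1)"

definition R :: "nat \<Rightarrow> ((nat \<Rightarrow>\<^sub>0 nat) \<Rightarrow>\<^sub>0 'k::field) set" where
  "R n = {p. \<forall>\<alpha>\<in>Poly_Mapping.keys p. Poly_Mapping.keys \<alpha> \<subseteq> {1..n}}"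

definition ideal_gen :: "nat \<Rightarrow> ((nat \<Rightarrow>\<^sub>0 nat) \<Rightarrow>\<^sub>0 'k::field) set \<Rightarrow> ((nat \<Rightarrow>\<^sub>0 nat) \<Rightarrow>\<^sub>0 'k) set" where
  "ideal_gen n S = {(\<Sum>s\<in>T. q s * s) | T q. finite T \<and> T \<subseteq> S \<and> (\<forall>s\<in>T. q s \<in> R n)}"

text \<open>
  Graded reverse lexicographic order with \<open>x\<^sub>1 > x\<^sub>2 > \<dots>\<close>: in equal degree, the smaller monomial
  is the one with the larger exponent at the last index where the two differ.
\<close>

definition grevlex_less :: "(nat \<Rightarrow>\<^sub>0 nat) \<Rightarrow> (nat \<Rightarrow>\<^sub>0 nat) \<Rightarrow> bool" where
  "grevlex_less \<alpha> \<beta> \<longleftrightarrow> mdeg \<alpha> < mdeg \<beta> \<or>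
     (mdeg \<alpha> = mdeg \<beta> \<and>
      (\<exists>k. Poly_Mapping.lookup \<alpha> k > Poly_Mapping.lookup \<beta> k \<and>
           (\<forall>j>k. Poly_Mapping.lookup \<alpha> j = Poly_Mapping.lookup \<beta> j)))"

definition lead_exp :: "((nat \<Rightarrow>\<^sub>0 nat) \<Rightarrow>\<^sub>0 'k::field) \<Rightarrow> (nat \<Rightarrow>\<^sub>0 nat)" where
  "lead_exp p = (THE \<alpha>. \<alpha> \<in> Poly_Mapping.keys p \<and>
     (\<forall>\<beta>\<in>Poly_Mapping.keys p. \<beta> \<noteq> \<alpha> \<longrightarrow> grevlex_less \<beta> \<alpha>))"

definition initial_ideal :: "nat \<Rightarrow> ((nat \<Rightarrow>\<^sub>0 nat) \<Rightarrow>\<^sub>0 'k::field) set \<Rightarrow> ((nat \<Rightarrow>\<^sub>0 nat) \<Rightarrow>\<^sub>0 'k) set" where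
  "initial_ideal n J = ideal_gen n {mono_of (lead_exp p) | p. p \<in> J \<and> p \<noteq> 0}"

definition standard_monomials ::
  "nat \<Rightarrow> ((nat \<Rightarrow>\<^sub>0 nat) \<Rightarrow>\<^sub>0 'k::field) set \<Rightarrow> nat \<Rightarrow> ((nat \<Rightarrow>\<^sub>0 nat) \<Rightarrow>\<^sub>0 'k) set" where
  "standard_monomials n J e = {mono_of \<alpha> | \<alpha>. \<alpha> \<in> exponents n e \<and> mono_of \<alpha> \<notin> initial_ideal n J}"

definition is_subfield :: "'k::field set \<Rightarrow> bool" where
  "is_subfield F \<longleftrightarrow> 0 \<in> F \<and> 1 \<in> F \<and>
     (\<forall>a\<in>F. \<forall>b\<in>F. a - b \<in> F \<and> a * b \<in> F) \<and> (\<forall>a\<in>F. inverse a \<in> F)"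

definition poly_eval :: "('i \<Rightarrow> 'k::field) \<Rightarrow> (('i \<Rightarrow>\<^sub>0 nat) \<Rightarrow>\<^sub>0 'k) \<Rightarrow> 'k" where
  "poly_eval c P = (\<Sum>m\<in>Poly_Mapping.keys P.
     Poly_Mapping.lookup P m * (\<Prod>v\<in>Poly_Mapping.keys m. c v ^ Poly_Mapping.lookup m v))"

definition alg_independent :: "'k::field set \<Rightarrow> 'i set \<Rightarrow> ('i \<Rightarrow> 'k) \<Rightarrow> bool" where
  "alg_independent F I c \<longleftrightarrow>
     (\<forall>P :: ('i \<Rightarrow>\<^sub>0 nat) \<Rightarrow>\<^sub>0 'k.
        (\<forall>m\<in>Poly_Mapping.keys P. Poly_Mapping.lookup P m \<in> F \<and> Poly_Mapping.keys m \<subseteq> I) \<and>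
        poly_eval c P = 0 \<longrightarrow> P = 0)"

definition generic_ideal ::
  "'k::field set \<Rightarrow> nat \<Rightarrow> (nat \<Rightarrow> nat) \<Rightarrow> ((nat \<Rightarrow>\<^sub>0 nat) \<Rightarrow>\<^sub>0 'k) set \<Rightarrow> bool" where
  "generic_ideal F n d J \<longleftrightarrow>
     (\<forall>i\<in>{1..n}. 1 \<le> d i) \<and>
     (\<exists>c :: nat \<times> (nat \<Rightarrow>\<^sub>0 nat) \<Rightarrow> 'k.
        alg_independent F (SIGMA i:{1..n}. exponents n (d i)) c \<and>
        J = ideal_gen n
              ((\<lambda>i. \<Sum>\<alpha>\<in>exponents n (d i). Poly_Mapping.single \<alpha> (c (i, \<alpha>))) ` {1..n}))"

text \<open>
  The sums over \<^term>\<open>exponents n e\<close> are genuine finite sums, and \<^const>\<open>lead_exp\<close> is the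
  grevlex-largest exponent of a nonzero polynomial.
\<close>

lemma finite_exponents: "finite (exponents n e)"
proof -
  let ?g = "\<lambda>\<alpha> :: nat \<Rightarrow>\<^sub>0 nat. Poly_Mapping.lookup \<alpha>"
  have "?g ` exponents n e \<subseteq> {f. \<forall>k. (k \<in> {1..n} \<longrightarrow> f k \<in> {..e}) \<and> (k \<notin> {1..n} \<longrightarrow> f k = 0)}"
  proof clarify
    fix \<alpha> k assume a: "\<alpha> \<in> exponents n e"
    have "Poly_Mapping.lookup \<alpha> k \<le> mdeg \<alpha>"
    proof (cases "k \<in> Poly_Mapping.keys \<alpha>")
      case True
      then show ?thesis unfolding mdeg_def by (intro member_le_sum) auto
    qed (simp add: in_keys_iff)
    with a show "(k \<in> {1..n} \<longrightarrow> Poly_Mapping.lookup \<alpha> k \<in> {..e}) \<and>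
        (k \<notin> {1..n} \<longrightarrow> Poly_Mapping.lookup \<alpha> k = 0)"
      by (auto simp: exponents_def in_keys_iff subset_iff)
  qed
  then have "finite (?g ` exponents n e)"
    by (rule finite_subset) (intro finite_set_of_finite_funs; simp)
  then show ?thesis
    by (rule finite_imageD) (simp add: inj_on_def)
qed

lemma grevlex_less_irrefl: "\<not> grevlex_less \<alpha> \<alpha>"
  by (simp add: grevlex_less_def)

lemma grevlex_less_trans:
  assumes "grevlex_less \<alpha> \<beta>" "grevlex_less \<beta> \<gamma>"
  shows "grevlex_less \<alpha> \<gamma>"
proof (cases "mdeg \<alpha> = mdeg \<beta> \<and> mdeg \<beta> = mdeg \<gamma>")
  case True
  with assms obtain k l where
    k: "Poly_Mapping.lookup \<alpha> k > Poly_Mapping.lookup \<beta> k"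
       "\<And>j. j > k \<Longrightarrow> Poly_Mapping.lookup \<alpha> j = Poly_Mapping.lookup \<beta> j" and
    l: "Poly_Mapping.lookup \<beta> l > Poly_Mapping.lookup \<gamma> l"
       "\<And>j. j > l \<Longrightarrow> Poly_Mapping.lookup \<beta> j = Poly_Mapping.lookup \<gamma> j"
    by (auto simp: grevlex_less_def)
  have "Poly_Mapping.lookup \<alpha> (max k l) > Poly_Mapping.lookup \<gamma> (max k l)"
    using k(1) l(1) k(2)[of l] l(2)[of k] by (cases k l rule: linorder_cases) (auto simp: max_def)
  moreover have "\<forall>j>max k l. Poly_Mapping.lookup \<alpha> j = Poly_Mapping.lookup \<gamma> j"
    using k(2) l(2) by simp
  ultimately have "\<exists>m. Poly_Mapping.lookup \<alpha> m > Poly_Mapping.lookup \<gamma> m \<and>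
      (\<forall>j>m. Poly_Mapping.lookup \<alpha> j = Poly_Mapping.lookup \<gamma> j)"
    by (intro exI[of _ "max k l"] conjI)
  with True show ?thesis by (simp add: grevlex_less_def)
qed (use assms in \<open>auto simp: grevlex_less_def\<close>)

lemma grevlex_less_total:
  assumes "\<alpha> \<noteq> \<beta>"
  shows "grevlex_less \<alpha> \<beta> \<or> grevlex_less \<beta> \<alpha>"
proof (cases "mdeg \<alpha> = mdeg \<beta>")
  case True
  let ?D = "{k. Poly_Mapping.lookup \<alpha> k \<noteq> Poly_Mapping.lookup \<beta> k}"
  have fin: "finite ?D"
    by (rule finite_subset[of _ "Poly_Mapping.keys \<alpha> \<union> Poly_Mapping.keys \<beta>"])
       (auto simp: in_keys_iff)
  have ne: "?D \<noteq> {}"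
    using assms by (auto simp: poly_mapping_eq_iff fun_eq_iff)
  obtain m where m: "m = Max ?D" by simp
  have "m \<in> ?D" unfolding m by (rule Max_in[OF fin ne])
  have eq: "Poly_Mapping.lookup \<alpha> j = Poly_Mapping.lookup \<beta> j" if "j > m" for j
  proof (rule ccontr)
    assume "Poly_Mapping.lookup \<alpha> j \<noteq> Poly_Mapping.lookup \<beta> j"
    then have "j \<le> m" unfolding m by (intro Max_ge[OF fin]) simp
    with that show False by simp
  qed
  from \<open>m \<in> ?D\<close> consider "Poly_Mapping.lookup \<alpha> m > Poly_Mapping.lookup \<beta> m"
    | "Poly_Mapping.lookup \<beta> m > Poly_Mapping.lookup \<alpha> m" by fastforce
  then show ?thesis
  proof cases
    case 1
    with eq have "grevlex_less \<alpha> \<beta>"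
      unfolding grevlex_less_def using True by (intro disjI2 conjI exI[of _ m]) auto
    then show ?thesis ..
  next
    case 2
    with eq have "grevlex_less \<beta> \<alpha>"
      unfolding grevlex_less_def using True by (intro disjI2 conjI exI[of _ m]) auto
    then show ?thesis ..
  qed
qed (auto simp: grevlex_less_def)

lemma lead_exp:
  assumes "p \<noteq> 0"
  shows "lead_exp p \<in> Poly_Mapping.keys p"
    and "\<beta> \<in> Poly_Mapping.keys p \<Longrightarrow> \<beta> \<noteq> lead_exp p \<Longrightarrow> grevlex_less \<beta> (lead_exp p)"
proof -
  have ex: "\<exists>\<alpha>\<in>A. \<forall>\<beta>\<in>A. \<beta> \<noteq> \<alpha> \<longrightarrow> grevlex_less \<beta> \<alpha>" if "finite A" "A \<noteq> {}" for A
    using that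
  proof (induction rule: finite_ne_induct)
    case (insert x A)
    then obtain \<alpha> where \<alpha>: "\<alpha> \<in> A" "\<forall>\<beta>\<in>A. \<beta> \<noteq> \<alpha> \<longrightarrow> grevlex_less \<beta> \<alpha>" by blast
    with insert.hyps have "x \<noteq> \<alpha>" by blast
    then consider "grevlex_less x \<alpha>" | "grevlex_less \<alpha> x" using grevlex_less_total by blast
    then show ?case
    proof cases
      case 1
      with \<alpha> show ?thesis by (intro bexI[of _ \<alpha>]) auto
    next
      case 2
      with \<alpha> have "grevlex_less \<beta> x" if "\<beta> \<in> A" for \<beta>
        using that grevlex_less_trans by (cases "\<beta> = \<alpha>") auto
      then show ?thesis by (intro bexI[of _ x]) auto
    qed
  qed simp
  let ?Q = "\<lambda>\<alpha>. \<alpha> \<in> Poly_Mapping.keys p \<and>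
    (\<forall>\<beta>\<in>Poly_Mapping.keys p. \<beta> \<noteq> \<alpha> \<longrightarrow> grevlex_less \<beta> \<alpha>)"
  have "\<exists>\<alpha>. ?Q \<alpha>"
    using ex[of "Poly_Mapping.keys p"] assms by (simp add: Bex_def)
  moreover have "\<alpha> = \<alpha>'" if "?Q \<alpha>" "?Q \<alpha>'" for \<alpha> \<alpha>'
  proof (rule ccontr)
    assume "\<alpha> \<noteq> \<alpha>'"
    with that have "grevlex_less \<alpha> \<alpha>'" "grevlex_less \<alpha>' \<alpha>" by auto
    then show False using grevlex_less_trans grevlex_less_irrefl by blast
  qed
  ultimately have "\<exists>!\<alpha>. ?Q \<alpha>" by (rule ex_ex1I)
  then have "?Q (lead_exp p)" unfolding lead_exp_def by (rule theI')
  then show "lead_exp p \<in> Poly_Mapping.keys p"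
    and "\<beta> \<in> Poly_Mapping.keys p \<Longrightarrow> \<beta> \<noteq> lead_exp p \<Longrightarrow> grevlex_less \<beta> (lead_exp p)"
    by auto
qed

end

theory Submission
  imports Defs "Jordan_Normal_Form.Determinant"
begin

text \<open>
  Put \<open>m = \<delta> - 2 i\<close> and let \<open>A\<close> be the quotient of \<open>K[x\<^sub>1, \<dots>, x\<^sub>n]\<close> by the generic ideal. Two facts about \<open>A\<close>
  imply the theorem: its components of degrees \<open>i\<close> and \<open>\<delta> - i\<close> have the same dimension, and
  multiplication by \<open>x\<^sub>n\<^sup>m\<close> maps the first onto the second. Indeed, by the second fact a standard monomial
  of degree \<open>\<delta> - i\<close> is congruent to a multiple of \<open>x\<^sub>n\<^sup>m\<close>, and the reverse lexicographic order then forces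
  \<open>x\<^sub>n\<^sup>m\<close> to divide it (\<open>standard_divisible_by_last\<close>). The cofactor is again standard, so \<open>B\<^bsub>\<delta> - i\<^esub>\<close> is
  contained in \<open>x\<^sub>n\<^sup>m B\<^sub>i\<close>, and by the first fact both sets have the same number of elements.

  Each fact is deduced from conditions of the form "these forms, whose coefficients are polynomials in
  the coefficients of the generators, span all forms of degree \<open>e\<close>". Such a condition follows from the
  nonvanishing of a determinant (\<open>spanning_open\<close>), so it holds for generic coefficients as soon as
  it holds for one choice of generators of the same degrees over \<open>K\<close> (\<open>generic_nonzero\<close>).

  For the dimensions the choice is \<open>x\<^sub>j\<^bsup>d j\<^esup>\<close>. It shows that generically the quotient has as many standard
  monomials of each degree as there are monomials with all exponents \<open>\<alpha>\<^sub>j < d\<^sub>j\<close>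
  (\<open>card_standard_exps_eq_box\<close>), and this number is symmetric.

  For the surjectivity the powers of the variables would not do, even in other coordinates, because in
  positive characteristic their quotient need not have the strong Lefschetz property. Products of linear forms work in
  every characteristic (\<open>exists_lefschetz_products\<close>). They are found by induction through a degeneration:
  let two generators acquire a common factor \<open>x\<close>, so that they become \<open>x a\<close> and \<open>x b\<close>. If they do so as
  \<open>x a\<close> and \<open>(x + t w) b\<close> with \<open>t\<close> tending to 0, the limit of the ideals contains \<open>w a b\<close> as well. In the quotient
  by the limit ideal, the multiples of \<open>x\<close> come from the quotient of type \<open>(d\<^sub>1 - 1, d\<^sub>2 - 1, d\<^sub>3, \<dots>)\<close>, shifted
  by one degree, and modulo \<open>x\<close> one finds the quotient of type \<open>(d\<^sub>1 + d\<^sub>2 - 1, d\<^sub>3, \<dots>)\<close> in one variable less.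
  Both are symmetric about the same degree \<open>\<delta>/2\<close>, so the surjectivity for these two smaller types gives
  it for the limit and then, spanning being an open condition, for some \<open>t \<noteq> 0\<close>.
\<close>

section \<open>Forms and the ideals they generate\<close>

type_synonym 'k mpoly = "(nat \<Rightarrow>\<^sub>0 nat) \<Rightarrow>\<^sub>0 'k"

abbreviation coef :: "('a \<Rightarrow>\<^sub>0 'b::zero) \<Rightarrow> 'a \<Rightarrow> 'b" where "coef \<equiv> Poly_Mapping.lookup"
abbreviation supp :: "('a \<Rightarrow>\<^sub>0 'b::zero) \<Rightarrow> 'a set" where "supp \<equiv> Poly_Mapping.keys"
abbreviation const :: "'k \<Rightarrow> 'k::field mpoly" where "const \<equiv> Poly_Mapping.single 0"

lemma coef_const_mult [simp]: "coef (const c * p) \<alpha> = c * coef p \<alpha>"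
  by (simp add: mult_map_scale_conv_mult [symmetric] map.rep_eq when_def)

interpretation vs: vector_space "\<lambda>c p :: 'k::field mpoly. const c * p"
  by unfold_locales (simp_all add: algebra_simps single_add mult_single flip: mult.assoc)

interpretation idl: Modules.module "\<lambda>q p :: 'k::field mpoly. q * p"
  by unfold_locales (simp_all add: algebra_simps)

text \<open>These two rules re-associate products to the left and make the simplifier loop with
  mult.assoc.\<close>

declare idl.scale_scale [simp del] vs.scale_scale [simp del]

lemma single_eq_const_mult: "Poly_Mapping.single \<alpha> c = const c * mono_of \<alpha>"
  by (simp add: mono_of_def mult_single)

lemma poly_eq_sum_single: "p = (\<Sum>\<alpha>\<in>supp p. Poly_Mapping.single \<alpha> (coef p \<alpha>))"
  by (rule poly_mapping_eqI)
    (auto simp: lookup_sum lookup_single when_def in_keys_iff)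

lemma poly_eq_sum_mono: "p = (\<Sum>\<alpha>\<in>supp p. const (coef p \<alpha>) * mono_of \<alpha>)"
  using poly_eq_sum_single[of p] unfolding single_eq_const_mult[symmetric] .

lemma mono_of_mult: "mono_of \<alpha> * mono_of \<beta> = mono_of (\<alpha> + \<beta>)"
  by (simp add: mono_of_def mult_single)

lemma coef_mono_of: "coef (mono_of \<alpha>) \<beta> = (if \<alpha> = \<beta> then 1 else 0)"
  by (simp add: mono_of_def lookup_single when_def)

lemma supp_mono_of [simp]: "supp (mono_of \<alpha> :: 'k::field mpoly) = {\<alpha>}"
  by (simp add: mono_of_def)

lemma mono_of_inject [simp]: "mono_of \<alpha> = (mono_of \<beta> :: 'k::field mpoly) \<longleftrightarrow> \<alpha> = \<beta>"
  by (metis supp_mono_of singleton_inject)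

lemma mdeg_add: "mdeg (\<alpha> + \<beta>) = mdeg \<alpha> + mdeg \<beta>"
  unfolding mdeg_def by (rule setsum_keys_plus_distrib) auto

lemma mdeg_zero [simp]: "mdeg 0 = 0"
  by (simp add: mdeg_def)

lemma mdeg_single [simp]: "mdeg (Poly_Mapping.single k a) = a"
  by (simp add: mdeg_def)

lemma supp_add_nat: "supp (\<alpha> + \<beta>) = supp \<alpha> \<union> supp (\<beta> :: nat \<Rightarrow>\<^sub>0 nat)"
  by (auto simp: in_keys_iff lookup_add)

lemma mdeg_eq_sum:
  assumes "finite X" "supp \<alpha> \<subseteq> X"
  shows "mdeg \<alpha> = (\<Sum>k\<in>X. coef \<alpha> k)"
  unfolding mdeg_def using assms
  by (intro sum.mono_neutral_left) (auto simp: in_keys_iff)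

definition exps :: "nat set \<Rightarrow> nat \<Rightarrow> (nat \<Rightarrow>\<^sub>0 nat) set" where
  "exps X e = {\<alpha>. supp \<alpha> \<subseteq> X \<and> mdeg \<alpha> = e}"

lemma exponents_eq_exps: "exponents n e = exps {1..n} e"
  by (simp add: exponents_def exps_def)

lemma finite_exps:
  assumes "finite X"
  shows "finite (exps X e)"
proof -
  have "coef ` exps X e \<subseteq>
      {f. \<forall>k. (k \<in> X \<longrightarrow> f k \<in> {..e}) \<and> (k \<notin> X \<longrightarrow> f k = 0)}"
    using assms by (auto simp: exps_def mdeg_eq_sum[OF assms] in_keys_iff intro: member_le_sum)
  then have "finite (coef ` exps X e)"
    by (rule finite_subset) (intro finite_set_of_finite_funs; simp add: assms)
  then show ?thesis
    by (rule finite_imageD) (simp add: inj_on_def)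
qed

lemma exps_add: "\<alpha> \<in> exps X d \<Longrightarrow> \<beta> \<in> exps X e \<Longrightarrow> \<alpha> + \<beta> \<in> exps X (d + e)"
  by (auto simp: exps_def mdeg_add supp_add_nat)

lemma add_mem_exps_iff:
  assumes "\<beta> \<in> exps X d"
  shows "\<gamma> + \<beta> \<in> exps X e \<longleftrightarrow> d \<le> e \<and> \<gamma> \<in> exps X (e - d)"
  using assms by (auto simp: exps_def mdeg_add supp_add_nat)

definition forms :: "nat set \<Rightarrow> nat \<Rightarrow> 'k::field mpoly set" where
  "forms X e = {p. supp p \<subseteq> exps X e}"

lemma forms_iff_coef: "p \<in> forms X e \<longleftrightarrow> (\<forall>\<alpha>. \<alpha> \<notin> exps X e \<longrightarrow> coef p \<alpha> = 0)"
  by (auto simp: forms_def in_keys_iff)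

lemma subspace_forms: "vs.subspace (forms X e)"
  by (simp add: vs.subspace_def forms_iff_coef lookup_add)

lemma mono_of_in_forms [simp]: "mono_of \<alpha> \<in> forms X e \<longleftrightarrow> \<alpha> \<in> exps X e"
  by (simp add: forms_def)

lemma forms_mult: "p \<in> forms X d \<Longrightarrow> q \<in> forms X e \<Longrightarrow> p * q \<in> forms X (d + e)"
  using keys_mult[of p q] exps_add by (fastforce simp: forms_def)

lemma one_in_forms: "1 \<in> forms X 0"
  by (simp add: forms_def exps_def flip: single_one)

lemma forms_prod:
  assumes "\<And>k. k \<in> D \<Longrightarrow> L k \<in> forms X 1"
  shows "(\<Prod>k\<in>D. L k) \<in> forms X (card D)"
  using assms
proof (induction D rule: infinite_finite_induct)
  case (insert k D)
  then show ?case using forms_mult[of "L k" X 1 "prod L D" "card D"] by simp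
qed (simp_all add: one_in_forms)

lemma forms_power: "p \<in> forms X d \<Longrightarrow> p ^ m \<in> forms X (d * m)"
  proof (induction m)
  case (Suc m)
  then show ?case using forms_mult[of p X d "p ^ m" "d * m"] by simp
qed (simp add: one_in_forms)

lemma forms_span: "(forms X e :: 'k::field mpoly set) = vs.span (mono_of ` exps X e)"
proof
  show "(forms X e :: 'k mpoly set) \<subseteq> vs.span (mono_of ` exps X e)"
  proof
    fix p :: "'k mpoly" assume p: "p \<in> forms X e"
    have "(\<Sum>\<alpha>\<in>supp p. const (coef p \<alpha>) * mono_of \<alpha>) \<in> vs.span (mono_of ` exps X e)"
      using p by (intro vs.span_sum vs.span_scale vs.span_base) (auto simp: forms_def)
    then show "p \<in> vs.span (mono_of ` exps X e)"
      by (subst poly_eq_sum_mono)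
  qed
qed (rule vs.span_minimal, auto simp: subspace_forms)

lemma independent_mono_of: "vs.independent (mono_of ` A :: 'k::field mpoly set)"
proof (unfold vs.independent_explicit_finite_subsets, intro allI impI ballI)
  fix S :: "'k mpoly set" and u v
  assume S: "S \<subseteq> mono_of ` A" "finite S" and z: "(\<Sum>v\<in>S. const (u v) * v) = 0" and v: "v \<in> S"
  from S v obtain \<alpha> where \<alpha>: "v = mono_of \<alpha>" by blast
  have "0 = coef (\<Sum>v\<in>S. const (u v) * v) \<alpha>" by (simp only: z lookup_zero)
  also have "\<dots> = (\<Sum>w\<in>S. if w = v then u v else 0)"
    unfolding lookup_sum using S(1) by (intro sum.cong refl) (auto simp: coef_mono_of \<alpha>)
  also have "\<dots> = u v" using S(2) v by simp
  finally show "u v = 0" by simp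
qed

lemma inj_mono_of: "inj_on (mono_of :: _ \<Rightarrow> 'k::field mpoly) A"
  by (simp add: inj_on_def)

subsection \<open>Graded pieces of ideals with homogeneous generators\<close>

text \<open>
  Deleting from a polynomial all terms outside \<open>exps X e\<close> replaces the cofactors in a combination of
  homogeneous generators by forms of the complementary degrees, and at the same time removes the
  variables outside \<open>X\<close>. So ideals may be taken in the ring with all the variables, where they are
  the spans of a module, and still be cut down to forms over \<open>X\<close>.
\<close>

definition component :: "nat set \<Rightarrow> nat \<Rightarrow> 'k::field mpoly \<Rightarrow> 'k mpoly" where
  "component X e p = (\<Sum>\<alpha>\<in>supp p \<inter> exps X e. Poly_Mapping.single \<alpha> (coef p \<alpha>))"

lemma coef_component: "coef (component X e p) \<alpha> = (if \<alpha> \<in> exps X e then coef p \<alpha> else 0)"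
  by (auto simp: component_def lookup_sum lookup_single when_def in_keys_iff)

lemma component_add: "component X e (p + q) = component X e p + component X e q"
  by (rule poly_mapping_eqI) (simp add: coef_component lookup_add)

lemma component_zero [simp]: "component X e 0 = 0"
  by (rule poly_mapping_eqI) (simp add: coef_component)

lemma component_sum: "component X e (sum f A) = (\<Sum>a\<in>A. component X e (f a))"
  by (rule poly_mapping_eqI) (simp add: coef_component lookup_sum)

lemma component_form: "p \<in> forms X e \<Longrightarrow> component X e p = p"
  by (rule poly_mapping_eqI) (auto simp: coef_component forms_def in_keys_iff)

lemma component_in_forms: "component X e p \<in> forms X e"
  by (auto simp: forms_def in_keys_iff coef_component split: if_splits)

lemma supp_single_mult: "supp (Poly_Mapping.single \<gamma> c * p) \<subseteq> (+) \<gamma> ` supp p"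
  using keys_mult[of "Poly_Mapping.single \<gamma> c" p] by (auto split: if_splits)

lemma component_single_mult:
  assumes "f \<in> forms X d"
  shows "component X e (Poly_Mapping.single \<gamma> c * f) =
    (if d \<le> e \<and> \<gamma> \<in> exps X (e - d) then Poly_Mapping.single \<gamma> c * f else 0)"
proof -
  have "\<alpha> \<in> exps X e \<longleftrightarrow> d \<le> e \<and> \<gamma> \<in> exps X (e - d)"
    if "\<alpha> \<in> supp (Poly_Mapping.single \<gamma> c * f)" for \<alpha>
    using that assms supp_single_mult[of \<gamma> c f] add_mem_exps_iff[of _ X d \<gamma> e]
    by (auto simp: forms_def)
  then show ?thesis
    by (intro poly_mapping_eqI) (auto simp: coef_component in_keys_iff)
qed

text \<open>
  An index set for the products of a monomial with a generator that have degree \<open>e\<close>; such products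
  span the degree \<open>e\<close> part of the ideal.
\<close>

definition multiples :: "nat set \<Rightarrow> nat \<Rightarrow> ('a \<Rightarrow> nat) \<Rightarrow> 'a set \<Rightarrow> ('a \<times> (nat \<Rightarrow>\<^sub>0 nat)) set" where
  "multiples X e deg A = (SIGMA a:{a\<in>A. deg a \<le> e}. exps X (e - deg a))"

lemma component_ideal:
  assumes "\<And>a. a \<in> A \<Longrightarrow> g a \<in> forms X (deg a)" "p \<in> idl.span (g ` A)"
  shows "component X e p \<in> vs.span ((\<lambda>(a, \<gamma>). mono_of \<gamma> * g a) ` multiples X e deg A)"
    (is "_ \<in> vs.span ?M")
  using assms(2)
proof (induction rule: idl.span_induct_alt)
  case base
  then show ?case by (simp add: vs.span_zero)
next
  case (step q f r)
  then obtain a where a: "a \<in> A" "f = g a" by blast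
  have "component X e (Poly_Mapping.single \<gamma> c * f) \<in> vs.span ?M" for \<gamma> c
  proof (cases "deg a \<le> e \<and> \<gamma> \<in> exps X (e - deg a)")
    case True
    then have "mono_of \<gamma> * g a \<in> ?M" using a by (force simp: multiples_def)
    then have "const c * (mono_of \<gamma> * g a) \<in> vs.span ?M" by (intro vs.span_scale vs.span_base)
    moreover have "component X e (Poly_Mapping.single \<gamma> c * f) = const c * (mono_of \<gamma> * g a)"
      using True component_single_mult[OF assms(1)[OF a(1)], of e \<gamma> c] a(2)
      unfolding mult.assoc[symmetric] single_eq_const_mult[symmetric] by simp
    ultimately show ?thesis by simp
  next
    case False
    then show ?thesis
      using component_single_mult[OF assms(1)[OF a(1)], of e \<gamma> c] a(2)
      by (auto simp: vs.span_zero)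
  qed
  moreover have "component X e (q * f) =
      (\<Sum>\<gamma>\<in>supp q. component X e (Poly_Mapping.single \<gamma> (coef q \<gamma>) * f))"
    by (subst poly_eq_sum_single[of q]) (simp only: sum_distrib_right component_sum)
  ultimately have "component X e (q * f) \<in> vs.span ?M" by (simp add: vs.span_sum)
  with step.IH show ?case by (simp add: component_add vs.span_add)
qed

lemma forms_inter_ideal:
  assumes "\<And>a. a \<in> A \<Longrightarrow> g a \<in> forms X (deg a)" "p \<in> idl.span (g ` A)" "p \<in> forms X e"
  shows "p \<in> vs.span ((\<lambda>(a, \<gamma>). mono_of \<gamma> * g a) ` multiples X e deg A)"
  using component_ideal[OF assms(1,2), of e] component_form[OF assms(3)] by simp

lemma subspace_ideal: "vs.subspace (idl.span S)"
  by (simp add: vs.subspace_def idl.span_zero idl.span_add idl.span_scale)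

lemma span_multiples_in_ideal:
  "vs.span ((\<lambda>(a, \<gamma>). mono_of \<gamma> * g a) ` multiples X e deg A) \<subseteq> idl.span (g ` A)"
  by (rule vs.span_minimal[OF _ subspace_ideal])
    (auto simp: multiples_def intro!: idl.span_scale[OF idl.span_base])

lemmas forms_zero = vs.subspace_0[OF subspace_forms]
lemmas forms_add = vs.subspace_add[OF subspace_forms]
lemmas forms_diff = vs.subspace_diff[OF subspace_forms]
lemmas forms_scale = vs.subspace_scale[OF subspace_forms]

lemma var_power: "var k ^ m = (mono_of (Poly_Mapping.single k m) :: 'k::field mpoly)"
proof (induction m)
  case 0
  show ?case by (simp add: mono_of_def)
next
  case (Suc m)
  then show ?case by (simp add: var_def mono_of_mult flip: single_add)
qed

lemma var_in_forms: "k \<in> X \<Longrightarrow> var k \<in> forms X 1"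
  by (simp add: var_def exps_def)

lemma component_mult_form:
  assumes "f \<in> forms X d"
  shows "component X e (q * f) = (if d \<le> e then component X (e - d) q * f else 0)"
proof -
  have "component X e (q * f) =
      (\<Sum>\<gamma>\<in>supp q. component X e (Poly_Mapping.single \<gamma> (coef q \<gamma>) * f))"
    by (subst poly_eq_sum_single[of q]) (simp only: sum_distrib_right component_sum)
  also have "\<dots> = (\<Sum>\<gamma>\<in>supp q. if d \<le> e \<and> \<gamma> \<in> exps X (e - d)
      then Poly_Mapping.single \<gamma> (coef q \<gamma>) * f else 0)"
    by (simp only: component_single_mult[OF assms])
  also have "\<dots> = (if d \<le> e then component X (e - d) q * f else 0)"
    by (auto simp: component_def sum_distrib_right sum.inter_restrict intro!: sum.cong)
  finally show ?thesis .
qed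

definition homogeneous :: "nat set \<Rightarrow> 'k::field mpoly set \<Rightarrow> bool" where
  "homogeneous X G \<longleftrightarrow> (\<forall>g\<in>G. \<exists>d. g \<in> forms X d)"

text \<open>
  The zero form lies in \<open>forms X d\<close> for every \<open>d\<close>, so a degree has to be chosen.
\<close>

definition form_degree :: "nat set \<Rightarrow> 'k::field mpoly \<Rightarrow> nat" where
  "form_degree X g = (SOME d. g \<in> forms X d)"

lemma form_degree: "homogeneous X G \<Longrightarrow> g \<in> G \<Longrightarrow> g \<in> forms X (form_degree X g)"
  unfolding form_degree_def homogeneous_def by (rule someI_ex) blast

lemma component_in_ideal:
  assumes "homogeneous X G" "p \<in> idl.span G"
  shows "component X e p \<in> idl.span G"
  using component_ideal[of G "\<lambda>g. g" X "form_degree X" p e] form_degree[OF assms(1)] assms(2)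
    span_multiples_in_ideal[of "\<lambda>g. g" X e "form_degree X" G] by auto

text \<open>
  Taking components of degree \<open>e\<close> makes the cofactor of \<open>x\<close> homogeneous.
\<close>

lemma form_in_ideal_insert:
  assumes "homogeneous X G" "x \<in> forms X d" "p \<in> forms X e" "p \<in> idl.span (insert x G)"
  obtains q where "p - q * x \<in> idl.span G" "q = 0 \<or> d \<le> e \<and> q \<in> forms X (e - d)"
proof -
  obtain k where k: "p - k * x \<in> idl.span G"
    using assms(4) idl.span_breakdown_eq by blast
  define q where "q = (if d \<le> e then component X (e - d) k else 0)"
  have "component X e p = component X e (p - k * x) + component X e (k * x)"
    by (simp flip: component_add)
  moreover have "component X e (k * x) = q * x"
    unfolding component_mult_form[OF assms(2)] q_def by simp
  ultimately have "p = component X e (p - k * x) + q * x"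
    by (simp only: component_form[OF assms(3)])
  then have "p - q * x = component X e (p - k * x)"
    by (simp only: diff_eq_eq)
  with component_in_ideal[OF assms(1) k] show ?thesis
    by (intro that[of q]) (auto simp: q_def component_in_forms)
qed

lemma ideal_mult_transfer:
  assumes "\<And>s. s \<in> S \<Longrightarrow> s * x \<in> idl.span T" "q \<in> idl.span S"
  shows "q * x \<in> idl.span T"
  using assms(2)
proof (induction rule: idl.span_induct_alt)
  case (step c s y)
  show ?case
    using idl.span_add[OF idl.span_scale[OF assms(1)[OF step.hyps(1)], of c] step.IH]
    by (simp only: distrib_right mult.assoc)
qed (simp add: idl.span_zero)

lemma ideal_subset: "S \<subseteq> idl.span T \<Longrightarrow> idl.span S \<subseteq> idl.span T"
  by (rule idl.span_minimal) simp_all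

section \<open>Spanning is an open condition\<close>

text \<open>
  Abstracts from the polynomial dependence on parameters. Two instances occur: polynomial functions
  of one parameter, which have finitely many zeros, and polynomial functions of all the coefficients
  of \<open>n\<close> forms with coefficients in \<open>F\<close>, which do not vanish at algebraically independent coefficients,
  in both cases unless they are identically zero.
\<close>

locale function_ring =
  fixes \<D> :: "('t \<Rightarrow> 'k::field) set"
  assumes one: "(\<lambda>_. 1) \<in> \<D>"
    and diff: "f \<in> \<D> \<Longrightarrow> g \<in> \<D> \<Longrightarrow> (\<lambda>t. f t - g t) \<in> \<D>"
    and mult: "f \<in> \<D> \<Longrightarrow> g \<in> \<D> \<Longrightarrow> (\<lambda>t. f t * g t) \<in> \<D>"
begin

lemma zero: "(\<lambda>_. 0) \<in> \<D>"
  using diff[OF one one] by simp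

lemma add: "f \<in> \<D> \<Longrightarrow> g \<in> \<D> \<Longrightarrow> (\<lambda>t. f t + g t) \<in> \<D>"
  using diff[OF _ diff[OF zero], of f g] by simp

lemma sum: "(\<And>a. a \<in> A \<Longrightarrow> f a \<in> \<D>) \<Longrightarrow> (\<lambda>t. \<Sum>a\<in>A. f a t) \<in> \<D>"
  by (induction A rule: infinite_finite_induct) (auto intro: zero add)

lemma prod: "(\<And>a. a \<in> A \<Longrightarrow> f a \<in> \<D>) \<Longrightarrow> (\<lambda>t. \<Prod>a\<in>A. f a t) \<in> \<D>"
  by (induction A rule: infinite_finite_induct) (auto intro: one mult)

lemma det:
  assumes "\<And>k l. k < N \<Longrightarrow> l < N \<Longrightarrow> (\<lambda>t. m t k l) \<in> \<D>"
  shows "(\<lambda>t. det (mat N N (\<lambda>(k, l). m t k l))) \<in> \<D>"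
proof -
  have "(\<lambda>t. signof p) \<in> \<D>" for p :: "nat \<Rightarrow> nat"
    using one diff[OF zero one] by (cases "sign p = (1::int)") (auto simp: sign_def)
  moreover have "det (mat N N (\<lambda>(k, l). m t k l)) =
      (\<Sum>p \<in> {p. p permutes {0..<N}}. signof p * (\<Prod>i = 0..<N. m t i (p i)))" for t
    unfolding det_def
    by (auto intro!: sum.cong prod.cong simp: permutes_in_image)
  ultimately show ?thesis
    using assms by (auto intro!: sum mult prod simp: permutes_in_image)
qed

definition family :: "nat set \<Rightarrow> nat \<Rightarrow> ('t \<Rightarrow> 'k mpoly) \<Rightarrow> bool" where
  "family X e g \<longleftrightarrow> (\<forall>t. g t \<in> forms X e) \<and> (\<forall>\<alpha>. (\<lambda>t. coef (g t) \<alpha>) \<in> \<D>)"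

text \<open>
  If the forms at the parameter \<open>t0\<close> span, some of them are a basis. The determinant of their
  coefficient matrix is a function of the parameter; wherever it is nonzero the same forms still
  span, because the adjugate expresses every monomial through them.
\<close>

lemma spanning_open:
  assumes fin: "finite X" and fam: "\<And>a. a \<in> A \<Longrightarrow> family X e (v a)"
    and span: "forms X e \<subseteq> vs.span ((\<lambda>a. v a t0) ` A)"
  shows "\<exists>D\<in>\<D>. D t0 \<noteq> 0 \<and> (\<forall>t. D t \<noteq> 0 \<longrightarrow> forms X e \<subseteq> vs.span ((\<lambda>a. v a t) ` A))"
proof -
  let ?E = "mono_of ` exps X e :: 'k mpoly set"
  define N where "N = card (exps X e)"
  obtain B where B: "B \<subseteq> (\<lambda>a. v a t0) ` A" "vs.independent B" "(\<lambda>a. v a t0) ` A \<subseteq> vs.span B"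
    using vs.maximal_independent_subset by blast
  have "vs.span ((\<lambda>a. v a t0) ` A) \<subseteq> vs.span B"
    using B(3) by (intro vs.span_minimal) auto
  with span have FB: "forms X e \<subseteq> vs.span B" by blast
  have BF: "B \<subseteq> forms X e" using B(1) fam by (auto simp: family_def)
  then have "vs.span B = vs.span ?E"
    using FB vs.span_minimal[OF BF subspace_forms] by (auto simp: forms_span)
  from vs.bij_if_span_eq_span_bases[OF B(2) independent_mono_of this]
  obtain \<phi> where "bij_betw \<phi> B ?E" by blast
  then have cardB: "finite B" "card B = N"
    using finite_exps[OF fin, of e] bij_betw_finite[of \<phi> B ?E] bij_betw_same_card[of \<phi> B ?E]
    by (auto simp: N_def card_image[OF inj_mono_of])
  obtain b where b: "bij_betw b {0..<N} B"
    using ex_bij_betw_nat_finite[OF cardB(1)] cardB(2) by blast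
  obtain h where h: "bij_betw h {0..<N} (exps X e)"
    using ex_bij_betw_nat_finite[OF finite_exps[OF fin]] unfolding N_def by blast
  have "\<exists>a. a \<in> A \<and> v a t0 = b k" if "k < N" for k
    using b B(1) that by (force simp: bij_betw_def)
  then obtain a where a: "a k \<in> A" "v (a k) t0 = b k" if "k < N" for k by metis
  define m where "m t k l = coef (v (a k) t) (h l)" for t k l
  define M where "M t = mat N N (\<lambda>(k, l). m t k l)" for t
  have carrier: "M t \<in> carrier_mat N N" for t by (simp add: M_def)
  have hm: "h l \<in> exps X e" if "l < N" for l using h that by (auto simp: bij_betw_def)
  have hinj: "h l = h l' \<longleftrightarrow> l = l'" if "l < N" "l' < N" for l l'
    using h that by (auto simp: bij_betw_def inj_on_def)
  have hsurj: "\<exists>l<N. \<alpha> = h l" if "\<alpha> \<in> exps X e" for \<alpha>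
    using h that by (force simp: bij_betw_def)
  have "(\<lambda>t. det (M t)) \<in> \<D>"
    unfolding M_def using fam a by (intro det) (auto simp: m_def family_def)
  moreover have "det (M t0) \<noteq> 0"
  proof
    assume "det (M t0) = 0"
    then obtain w where w: "w \<in> carrier_vec N" "w \<noteq> 0\<^sub>v N" "M t0 *\<^sub>v w = 0\<^sub>v N"
      using det_0_iff_vec_prod_zero_field[OF carrier] by blast
    define \<phi> where "\<phi> p = (\<Sum>l<N. coef p (h l) * w $ l)" for p :: "'k mpoly"
    have sub: "vs.subspace {p. \<phi> p = 0}"
      by (auto simp: vs.subspace_def \<phi>_def lookup_add distrib_right sum.distrib mult.assoc
          simp flip: sum_distrib_left)
    have "\<phi> (b k) = 0" if "k < N" for k
    proof -
      have "0 = (M t0 *\<^sub>v w) $ k" using w(3) that by simp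
      also have "\<dots> = \<phi> (b k)"
        using that w(1) a(2)[OF that]
        by (auto simp: M_def scalar_prod_def \<phi>_def m_def lessThan_atLeast0)
      finally show ?thesis by simp
    qed
    then have "B \<subseteq> {p. \<phi> p = 0}" using b by (auto simp: bij_betw_def)
    then have all: "forms X e \<subseteq> {p. \<phi> p = 0}"
      using vs.span_minimal[OF _ sub] FB by blast
    have "w $ l = 0" if "l < N" for l
    proof -
      have "mono_of (h l) \<in> forms X e" using hm[OF that] by simp
      then have "\<phi> (mono_of (h l)) = 0" using all by blast
      then have "0 = \<phi> (mono_of (h l))" by simp
      also have "\<dots> = (\<Sum>l'<N. if l = l' then w $ l else 0)"
        unfolding \<phi>_def using that by (intro sum.cong) (auto simp: coef_mono_of hinj)
      finally show ?thesis using that by simp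
    qed
    with w(1,2) show False by (auto simp: vec_eq_iff)
  qed
  moreover have "forms X e \<subseteq> vs.span ((\<lambda>a. v a t) ` A)" if D: "det (M t) \<noteq> 0" for t
  proof -
    have "mono_of (h l) \<in> vs.span ((\<lambda>a. v a t) ` A)" if l: "l < N" for l
    proof -
      define c where "c k = adj_mat (M t) $$ (l, k) / det (M t)" for k
      have adj: "adj_mat (M t) \<in> carrier_mat N N" "adj_mat (M t) * M t = det (M t) \<cdot>\<^sub>m 1\<^sub>m N"
        using adj_mat[OF carrier] by auto
      have inv: "(\<Sum>k<N. c k * m t k l') = (if l = l' then 1 else 0)" if l': "l' < N" for l'
      proof -
        have "(adj_mat (M t) * M t) $$ (l, l') = (\<Sum>k<N. adj_mat (M t) $$ (l, k) * m t k l')"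
          using adj(1) carrier[of t] l l'
          by (simp add: scalar_prod_def lessThan_atLeast0) (simp add: M_def)
        then have "(\<Sum>k<N. adj_mat (M t) $$ (l, k) * m t k l') = (if l = l' then det (M t) else 0)"
          using l l' by (cases "l = l'") (simp_all add: adj(2))
        then show ?thesis
          using D by (auto simp: c_def simp flip: sum_divide_distrib)
      qed
      have eq: "mono_of (h l) = (\<Sum>k<N. const (c k) * v (a k) t)"
      proof (rule poly_mapping_eqI)
        fix \<alpha>
        show "coef (mono_of (h l)) \<alpha> = coef (\<Sum>k<N. const (c k) * v (a k) t) \<alpha>"
        proof (cases "\<alpha> \<in> exps X e")
          case True
          then obtain l' where l': "l' < N" "\<alpha> = h l'" using hsurj by blast
          then show ?thesis
            using inv[OF l'(1)] l by (simp add: lookup_sum coef_mono_of hinj m_def)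
        next
          case False
          then have "\<alpha> \<notin> supp (v (a k) t)" if "k < N" for k
            using fam[OF a(1)[OF that]] by (auto simp: family_def forms_def)
          then have "coef (v (a k) t) \<alpha> = 0" if "k < N" for k
            using that by (simp add: in_keys_iff)
          then show ?thesis using False hm[OF l] by (auto simp: lookup_sum coef_mono_of)
        qed
      qed
      show ?thesis
        unfolding eq using a(1) by (intro vs.span_sum vs.span_scale vs.span_base) auto
    qed
    then show ?thesis
      unfolding forms_span using hsurj by (intro vs.span_minimal) auto
  qed
  ultimately show ?thesis
    by (intro bexI[of _ "\<lambda>t. det (M t)"] conjI allI impI)
qed

lemma family_mult:
  assumes fin: "finite X" and "family X d g" "family X e h"
  shows "family X (d + e) (\<lambda>t. g t * h t)"
proof -
  have exp: "p = (\<Sum>\<alpha>\<in>exps X c. Poly_Mapping.single \<alpha> (coef p \<alpha>))"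
    if "p \<in> forms X c" for p :: "'k mpoly" and c
    using that finite_exps[OF fin, of c]
    by (intro poly_mapping_eqI) (simp add: lookup_sum lookup_single when_def forms_iff_coef)
  have "coef (g t * h t) \<gamma> = (\<Sum>\<alpha>\<in>exps X d. \<Sum>\<beta>\<in>exps X e.
      coef (g t) \<alpha> * coef (h t) \<beta> * (if \<alpha> + \<beta> = \<gamma> then 1 else 0))" for t \<gamma>
    using assms by (subst exp[of "g t" d], simp add: family_def, subst exp[of "h t" e], simp add: family_def)
      (simp add: sum_product lookup_sum mult_single lookup_single when_def if_distrib cong: if_cong)
  moreover have "(\<lambda>t. if \<alpha> + \<beta> = \<gamma> then 1 else 0) \<in> \<D>" for \<alpha> \<beta> \<gamma> :: "nat \<Rightarrow>\<^sub>0 nat"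
    using one zero by simp
  ultimately show ?thesis
    using assms by (auto simp: family_def forms_mult intro!: sum mult)
qed

lemma family_const:
  assumes "p \<in> forms X e" "\<And>\<alpha>. (\<lambda>_. coef p \<alpha>) \<in> \<D>"
  shows "family X e (\<lambda>_. p)"
  using assms by (simp add: family_def)

lemma family_mono_of:
  assumes "\<gamma> \<in> exps X e"
  shows "family X e (\<lambda>_. mono_of \<gamma>)"
  using assms one zero by (intro family_const) (simp_all add: coef_mono_of)

text \<open>
  The degree \<open>e\<close> part of an ideal with homogeneous generators is the span of finitely many monomial
  multiples of the generators, so that containing all forms of degree \<open>e\<close> is a spanning condition.
\<close>

lemma ideal_open:
  assumes fin: "finite X" and fam: "\<And>a. a \<in> A \<Longrightarrow> family X (deg a) (g a)"
    and gen: "forms X e \<subseteq> idl.span ((\<lambda>a. g a t0) ` A)"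
  shows "\<exists>D\<in>\<D>. D t0 \<noteq> 0 \<and> (\<forall>t. D t \<noteq> 0 \<longrightarrow> forms X e \<subseteq> idl.span ((\<lambda>a. g a t) ` A))"
proof -
  let ?v = "\<lambda>(a, \<gamma>) t. mono_of \<gamma> * g a t"
  let ?I = "multiples X e deg A"
  have gf: "g a t \<in> forms X (deg a)" if "a \<in> A" for a t
    using fam[OF that] by (simp add: family_def)
  have im: "(\<lambda>i. ?v i t) ` ?I = (\<lambda>(a, \<gamma>). mono_of \<gamma> * g a t) ` ?I" for t
    by (auto simp: case_prod_unfold)
  have "forms X e \<subseteq> vs.span ((\<lambda>i. ?v i t0) ` ?I)"
    unfolding im using gen forms_inter_ideal[of A "\<lambda>a. g a t0", OF gf] by blast
  moreover have "family X e (?v i)" if i_in: "i \<in> ?I" for i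
  proof -
    obtain a \<gamma> where i: "i = (a, \<gamma>)" "a \<in> A" "deg a \<le> e" "\<gamma> \<in> exps X (e - deg a)"
      using i_in by (auto simp: multiples_def)
    show ?thesis
      using family_mult[OF fin family_mono_of[OF i(4)] fam[OF i(2)]] i(1,3) by simp
  qed
  ultimately obtain D where D: "D \<in> \<D>" "D t0 \<noteq> 0"
      "\<And>t. D t \<noteq> 0 \<Longrightarrow> forms X e \<subseteq> vs.span ((\<lambda>i. ?v i t) ` ?I)"
    using spanning_open[OF fin, of ?I e ?v t0] by blast
  have "forms X e \<subseteq> idl.span ((\<lambda>a. g a t) ` A)" if "D t \<noteq> 0" for t
    using D(3)[OF that] span_multiples_in_ideal[of "\<lambda>a. g a t"] unfolding im by blast
  with D(1,2) show ?thesis by blast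
qed

lemma family_one: "family X 0 (\<lambda>_. 1)"
  using one zero by (simp add: family_def one_in_forms lookup_one when_def)

lemma family_prod:
  assumes "finite X" "\<And>k. k \<in> D \<Longrightarrow> family X 1 (L k)"
  shows "family X (card D) (\<lambda>t. \<Prod>k\<in>D. L k t)"
  using assms(2)
proof (induction D rule: infinite_finite_induct)
  case (insert k D)
  then show ?case
    using family_mult[OF assms(1), of 1 "L k" "card D" "\<lambda>t. \<Prod>k\<in>D. L k t"] by simp
qed (simp_all add: family_one)

end

section \<open>The Lefschetz property for products of linear forms\<close>

interpretation curve: function_ring "range (poly :: 'k::field poly \<Rightarrow> 'k \<Rightarrow> 'k)"
proof
  show "(\<lambda>_. 1) \<in> range (poly :: 'k poly \<Rightarrow> 'k \<Rightarrow> 'k)"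
    by (rule image_eqI[of _ _ 1]) auto
  fix f g :: "'k \<Rightarrow> 'k" assume "f \<in> range poly" "g \<in> range poly"
  then obtain p q where "f = poly p" "g = poly q" by blast
  then have "(\<lambda>t. f t - g t) = poly (p - q)" "(\<lambda>t. f t * g t) = poly (p * q)"
    by (simp_all add: fun_eq_iff)
  then show "(\<lambda>t. f t - g t) \<in> range poly" "(\<lambda>t. f t * g t) \<in> range poly"
    by (simp_all only: rangeI)
qed

lemma constant_curve: "(\<lambda>_. c) \<in> range (poly :: 'k::field poly \<Rightarrow> 'k \<Rightarrow> 'k)"
  by (rule image_eqI[of _ _ "[:c:]"]) auto

lemma curve_line:
  assumes "p \<in> forms X e" "q \<in> forms X e"
  shows "curve.family X e (\<lambda>t. p + const t * q)"
proof -
  have "(\<lambda>t. coef (p + const t * q) \<alpha>) \<in> range poly" for \<alpha>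
    by (rule image_eqI[of _ _ "[:coef p \<alpha>, coef q \<alpha>:]"]) (auto simp: lookup_add)
  then show ?thesis
    by (auto simp: curve.family_def intro!: forms_add forms_scale assms)
qed

text \<open>
  Two configurations of linear forms are joined by a line, and an ideal that is large at one point of
  it is large at all but finitely many. This replaces the irreducibility of the parameter space: two
  such conditions that hold at different configurations hold together at some configuration.
\<close>

lemma ideal_open_on_line:
  fixes L M :: "'l \<Rightarrow> 'k::field mpoly"
  assumes "finite X" "\<And>k. L k \<in> forms X 1" "\<And>k. M k \<in> forms X 1" "homogeneous X S"
    and "forms X e \<subseteq> idl.span ((\<lambda>D. \<Prod>k\<in>D. L k + const u * M k) ` \<P> \<union> S)"
  shows "finite {t. \<not> forms X e \<subseteq> idl.span ((\<lambda>D. \<Prod>k\<in>D. L k + const t * M k) ` \<P> \<union> S)}"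
proof -
  define g :: "'l set + 'k mpoly \<Rightarrow> 'k \<Rightarrow> 'k mpoly" where
    "g a t = (case a of Inl D \<Rightarrow> \<Prod>k\<in>D. L k + const t * M k | Inr s \<Rightarrow> s)" for a t
  define A where "A = Inl ` \<P> \<union> Inr ` S"
  have im: "(\<lambda>a. g a t) ` A = (\<lambda>D. \<Prod>k\<in>D. L k + const t * M k) ` \<P> \<union> S" for t
    by (simp add: A_def g_def image_Un image_image)
  have "curve.family X (case_sum card (form_degree X) a) (g a)" if "a \<in> A" for a
  proof (cases a)
    case (Inl D)
    have "curve.family X (card D) (\<lambda>t. \<Prod>k\<in>D. L k + const t * M k)"
      by (intro curve.family_prod curve_line assms(1,2,3))
    then show ?thesis by (simp add: Inl g_def [abs_def])
  next
    case (Inr s)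
    then have "s \<in> S" using that by (auto simp: A_def)
    then have "curve.family X (form_degree X s) (\<lambda>_. s)"
      by (intro curve.family_const form_degree[OF assms(4)] constant_curve)
    then show ?thesis by (simp add: Inr g_def [abs_def])
  qed
  with curve.ideal_open[OF assms(1), of A "case_sum card (form_degree X)" g e u] assms(5)
  obtain D where D: "D \<in> range poly" "D u \<noteq> 0"
      "\<And>t. D t \<noteq> 0 \<Longrightarrow> forms X e \<subseteq> idl.span ((\<lambda>a. g a t) ` A)"
    unfolding im by blast
  then obtain P where P: "D = poly P" "P \<noteq> 0" by fastforce
  have "{t. \<not> forms X e \<subseteq> idl.span ((\<lambda>D. \<Prod>k\<in>D. L k + const t * M k) ` \<P> \<union> S)} \<subseteq> {t. poly P t = 0}"
    using D(3) unfolding im P(1) by blast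
  then show ?thesis using poly_roots_finite[OF P(2)] by (rule finite_subset)
qed

lemma ideal_with_one:
  assumes "1 \<in> S"
  shows "p \<in> idl.span S"
  using idl.span_scale[OF idl.span_base[OF assms], of p] by simp

lemma forms_mono: "Y \<subseteq> X \<Longrightarrow> forms Y e \<subseteq> forms X e"
  by (auto simp: forms_def exps_def)

lemma forms_in_ideal_if_monomials:
  assumes "\<And>\<alpha>. \<alpha> \<in> exps X e \<Longrightarrow> mono_of \<alpha> \<in> idl.span S"
  shows "forms X e \<subseteq> idl.span S"
  unfolding forms_span using assms by (intro vs.span_minimal[OF _ subspace_ideal]) auto

lemma mono_of_dvd:
  assumes "mono_of \<beta> \<in> S"
  shows "mono_of (\<gamma> + \<beta>) \<in> idl.span S"
  using idl.span_scale[OF idl.span_base[OF assms], of "mono_of \<gamma>"] by (simp add: mono_of_mult)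

text \<open>
  In one variable \<open>\<delta> = c - 1\<close>, and \<open>c - 1 + m \<le> 2 e\<close> forces \<open>c \<le> e\<close> or \<open>m \<le> e\<close>.
\<close>

lemma lefschetz_one_variable:
  assumes "c \<le> e \<or> m \<le> e"
  shows "forms {\<nu>} e \<subseteq> idl.span {var \<nu> ^ c, var \<nu> ^ m}"
proof (rule forms_in_ideal_if_monomials)
  fix \<alpha> assume "\<alpha> \<in> exps {\<nu>} e"
  then have \<alpha>: "\<alpha> = Poly_Mapping.single \<nu> e"
    by (intro poly_mapping_eqI) (auto simp: exps_def mdeg_eq_sum[of "{\<nu>}"] lookup_single when_def in_keys_iff)
  have "mono_of \<alpha> = var \<nu> ^ (e - k) * var \<nu> ^ k" if "k \<le> e" for k
    using that by (simp add: \<alpha> flip: var_power power_add)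
  then show "mono_of \<alpha> \<in> idl.span {var \<nu> ^ c, var \<nu> ^ m}"
    using assms by (metis idl.span_base idl.span_scale insertCI)
qed

text \<open>
  Let \<open>a\<close>, \<open>b\<close> be the products over \<open>D1 - {k1}\<close> and \<open>D2 - {k2}\<close>, let \<open>w\<close> be the linear form with
  label \<open>k2\<close>, and let \<open>z\<close> be the power of \<open>x\<^sub>\<nu>\<close>. The ideal
  \<open>(x a, x b, w a b, \<dots>, z)\<close> contains all forms of degree \<open>e\<close>: modulo \<open>x\<close> it is \<open>(w a b, \<dots>, z)\<close>,
  which is the first hypothesis, and what remains is \<open>x\<close> times a form of degree \<open>e - 1\<close>, which lies in
  \<open>(a, b, \<dots>, z)\<close> by the second one. Now replace \<open>x b\<close> by \<open>(x + t w) b\<close>. For almost all \<open>t\<close> the ideal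
  still contains the forms of degree \<open>e\<close>, and for \<open>t \<noteq> 0\<close> the generator \<open>w a b\<close> has become redundant,
  since \<open>t w a b = a (x + t w) b - b x a\<close>. The two generators left are products of as many linear
  forms as \<open>D1\<close> and \<open>D2\<close> have elements.
\<close>

lemma lefschetz_step:
  fixes L1 L2 :: "'l \<Rightarrow> 'k::field mpoly"
  assumes inf: "infinite (UNIV :: 'k set)" and X: "finite X" "x \<in> X" "\<nu> \<in> X"
    and D: "finite D1" "finite D2" "k1 \<in> D1" "k2 \<in> D2" "k1 \<notin> D2" "k2 \<notin> D1"
      "k1 \<notin> \<Union>\<R>" "k2 \<notin> \<Union>\<R>" "D1 \<inter> D2 = {}"
    and L1: "\<And>k. L1 k \<in> forms X 1"
      "forms X e \<subseteq> idl.span (prod L1 ` insert (D1 - {k1} \<union> D2) \<R> \<union> {var \<nu> ^ m, var x})"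
    and L2: "\<And>k. L2 k \<in> forms X 1"
      "1 \<le> e \<Longrightarrow> forms X (e - 1) \<subseteq>
        idl.span (prod L2 ` insert (D1 - {k1}) (insert (D2 - {k2}) \<R>) \<union> {var \<nu> ^ m})"
  shows "\<exists>L :: 'l \<Rightarrow> 'k mpoly. (\<forall>k. L k \<in> forms X 1) \<and>
    forms X e \<subseteq> idl.span (prod L ` insert D1 (insert D2 \<R>) \<union> {var \<nu> ^ m})"
proof -
  let ?x = "var x :: 'k mpoly" and ?z = "var \<nu> ^ m :: 'k mpoly"
  have x: "?x \<in> forms X 1" and z: "?z \<in> forms X m"
    using X var_in_forms[of x X] forms_power[OF var_in_forms[of \<nu> X], of m] by auto
  \<comment> \<open>on the line through \<open>L1\<close> and \<open>L2\<close> some point satisfies what is known of each of them\<close>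
  define L where "L t k = L1 k + const t * (L2 k - L1 k)" for t k
  have L_forms: "L t k \<in> forms X 1" for t k
    unfolding L_def by (intro forms_add forms_scale forms_diff L1 L2)
  have diff: "L2 k - L1 k \<in> forms X 1" for k
    by (intro forms_diff L1 L2)
  have L0: "L 0 = L1" and L1': "L 1 = L2" by (auto simp: L_def)
  let ?c1 = "\<lambda>t. forms X e \<subseteq> idl.span (prod (L t) ` insert (D1 - {k1} \<union> D2) \<R> \<union> {?z, ?x})"
  let ?c2 = "\<lambda>t. 1 \<le> e \<longrightarrow> forms X (e - 1) \<subseteq>
        idl.span (prod (L t) ` insert (D1 - {k1}) (insert (D2 - {k2}) \<R>) \<union> {?z})"
  have homog_xz: "homogeneous X {?z, ?x}" "homogeneous X {?z}" using x z by (auto simp: homogeneous_def)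
  have L_eq: "L t = (\<lambda>k. L1 k + const t * (L2 k - L1 k))" for t by (simp add: L_def fun_eq_iff)
  have open_line: "finite {t. \<not> forms X e' \<subseteq> idl.span (prod (L t) ` \<P> \<union> S)}"
    if "homogeneous X S" "forms X e' \<subseteq> idl.span (prod (L u) ` \<P> \<union> S)" for e' u \<P> S
    using ideal_open_on_line[OF X(1) L1(1) diff that(1)] that(2) unfolding L_eq .
  have "finite {t. \<not> ?c1 t}"
    by (rule open_line[where u = 0, OF homog_xz(1)]) (use L1(2) L0 in simp)
  moreover have "finite {t. \<not> ?c2 t}"
  proof (cases "1 \<le> e")
    case True
    have "finite {t. \<not> forms X (e - 1) \<subseteq>
        idl.span (prod (L t) ` insert (D1 - {k1}) (insert (D2 - {k2}) \<R>) \<union> {?z})}"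
      by (rule open_line[where u = 1, OF homog_xz(2)]) (use L2(2)[OF True] L1' in simp)
    then show ?thesis using True by simp
  qed simp
  ultimately have "finite ({t. \<not> ?c1 t} \<union> {t. \<not> ?c2 t})" by simp
  then obtain s where "s \<notin> {t. \<not> ?c1 t} \<union> {t. \<not> ?c2 t}"
    using ex_new_if_finite[OF inf] by blast
  then have c1: "?c1 s" and c2: "?c2 s" by auto
  define a b w where "a = prod (L s) (D1 - {k1})" and "b = prod (L s) (D2 - {k2})" and "w = L s k2"
  have ab: "prod (L s) (D1 - {k1} \<union> D2) = w * a * b"
  proof -
    have "prod (L s) (D1 - {k1} \<union> D2) = a * prod (L s) D2"
      unfolding a_def using D by (intro prod.union_disjoint) auto
    also have "prod (L s) D2 = w * b"
      unfolding b_def w_def using D by (intro prod.remove) auto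
    finally show ?thesis by (simp add: algebra_simps)
  qed
  have homog: "\<exists>d. prod (L s) D \<in> forms X d" for D
    using forms_prod[OF L_forms] by (rule exI)
  have wab: "\<exists>d. w * a * b \<in> forms X d" unfolding ab[symmetric] by (rule homog)
  define T where "T = {?x * a, ?x * b, w * a * b, ?z} \<union> prod (L s) ` \<R>"
  have T: "forms X e \<subseteq> idl.span T"
  proof
    fix p :: "'k mpoly" assume p: "p \<in> forms X e"
    let ?G = "insert (w * a * b) (insert ?z (prod (L s) ` \<R>))"
    have "homogeneous X ?G"
      unfolding homogeneous_def by (auto intro: homog wab exI[of _ m] z)
    moreover have "p \<in> idl.span (insert ?x ?G)"
      using c1 p ab by (auto simp: insert_commute)
    ultimately obtain q where q: "p - q * ?x \<in> idl.span ?G" "q = 0 \<or> 1 \<le> e \<and> q \<in> forms X (e - 1)"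
      using form_in_ideal_insert[OF _ x p] by metis
    have "q * ?x \<in> idl.span T"
    proof (cases "q = 0")
      case False
      then have "q \<in> idl.span (prod (L s) ` insert (D1 - {k1}) (insert (D2 - {k2}) \<R>) \<union> {?z})"
        using q(2) c2 by blast
      then show ?thesis
      proof (rule ideal_mult_transfer[rotated])
        fix g assume "g \<in> prod (L s) ` insert (D1 - {k1}) (insert (D2 - {k2}) \<R>) \<union> {?z}"
        then consider "g = a" | "g = b" | "g \<in> T" by (auto simp: a_def b_def T_def)
        then show "g * ?x \<in> idl.span T"
        proof cases
          case 3
          then show ?thesis
            using idl.span_scale[OF idl.span_base, of g T ?x] by (simp add: mult.commute)
        qed (auto simp: T_def mult.commute intro: idl.span_base)
      qed
    qed (simp add: idl.span_zero)
    moreover have "p - q * ?x \<in> idl.span T"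
      using q(1) idl.span_mono[of ?G T] by (auto simp: T_def)
    ultimately show "p \<in> idl.span T" using idl.span_add by fastforce
  qed
  \<comment> \<open>\<open>N' t\<close> differs from \<open>L s\<close> only in giving \<open>k1\<close> the form \<open>x\<close> and \<open>k2\<close> the form \<open>x + t w\<close>\<close>
  define N where "N = (L s)(k1 := ?x, k2 := ?x)"
  define M where "M k = (if k = k2 then w else 0)" for k
  define N' where "N' t k = N k + const t * M k" for t k
  have N_forms: "N k \<in> forms X 1" for k
    unfolding N_def fun_upd_apply using L_forms x by (auto split: if_split)
  have M_forms: "M k \<in> forms X 1" for k
    unfolding M_def w_def using L_forms[of s k2] forms_zero[of X 1] by (cases "k = k2") auto
  note forms = N_forms M_forms
  have N'1: "prod (N' t) D1 = ?x * a" for t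
  proof -
    have "prod (N' t) D1 = N' t k1 * prod (N' t) (D1 - {k1})" using D by (intro prod.remove) auto
    also have "prod (N' t) (D1 - {k1}) = a"
      unfolding a_def using D by (intro prod.cong) (auto simp: N'_def N_def M_def)
    finally show ?thesis using D by (auto simp: N'_def N_def M_def)
  qed
  have N'2: "prod (N' t) D2 = (?x + const t * w) * b" for t
  proof -
    have "prod (N' t) D2 = N' t k2 * prod (N' t) (D2 - {k2})" using D by (intro prod.remove) auto
    also have "prod (N' t) (D2 - {k2}) = b"
      unfolding b_def using D by (intro prod.cong) (auto simp: N'_def N_def M_def)
    finally show ?thesis by (simp add: N'_def N_def M_def)
  qed
  have N'R: "prod (N' t) ` \<R> = prod (L s) ` \<R>" for t
    using D by (intro image_cong refl prod.cong) (auto simp: N'_def N_def M_def)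
  have gens: "prod (N' t) ` insert D1 (insert D2 \<R>) \<union> {w * a * b, ?z} =
      {?x * a, (?x + const t * w) * b, w * a * b, ?z} \<union> prod (L s) ` \<R>" for t
    by (simp add: N'1 N'2 N'R insert_commute)
  have N'_eq: "N' t = (\<lambda>k. N k + const t * M k)" for t by (simp add: N'_def fun_eq_iff)
  have "homogeneous X {w * a * b, ?z}" using wab z by (auto simp: homogeneous_def)
  moreover have "forms X e \<subseteq>
      idl.span (prod (N' 0) ` insert D1 (insert D2 \<R>) \<union> {w * a * b, ?z})"
    unfolding gens using T by (simp add: T_def)
  ultimately have "finite {t. \<not> forms X e \<subseteq>
      idl.span (prod (N' t) ` insert D1 (insert D2 \<R>) \<union> {w * a * b, ?z})}"
    unfolding N'_eq by (rule ideal_open_on_line[OF X(1), of N M, OF forms])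
  then obtain t where t: "t \<noteq> 0" "forms X e \<subseteq>
      idl.span (prod (N' t) ` insert D1 (insert D2 \<R>) \<union> {w * a * b, ?z})"
    using ex_new_if_finite[OF inf, of "insert 0 _"] by (metis (mono_tags, lifting) finite_insert insertCI mem_Collect_eq)
  let ?G = "prod (N' t) ` insert D1 (insert D2 \<R>) \<union> {?z}"
  have G: "prod (N' t) D1 \<in> idl.span ?G" "prod (N' t) D2 \<in> idl.span ?G"
    by (auto intro!: idl.span_base)
  have "const (1 / t) * const t = (1 :: 'k mpoly)" using t(1) by (simp add: mult_single)
  then have "const (1 / t) * (const t * (w * a * b)) = w * a * b"
    by (simp flip: mult.assoc)
  moreover have "const t * (w * a * b) = a * prod (N' t) D2 - b * prod (N' t) D1"
    by (simp add: N'1 N'2 algebra_simps)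
  ultimately have "w * a * b = const (1 / t) * (a * prod (N' t) D2 - b * prod (N' t) D1)"
    by simp
  also have "\<dots> \<in> idl.span ?G"
    by (intro idl.span_scale idl.span_diff G)
  finally have "prod (N' t) ` insert D1 (insert D2 \<R>) \<union> {w * a * b, ?z} \<subseteq> idl.span ?G"
    using idl.span_superset[of ?G] by auto
  from ideal_subset[OF this] t(2) have in_G: "forms X e \<subseteq> idl.span ?G" by blast
  show ?thesis
  proof (intro exI[of _ "N' t"] conjI allI)
    show "N' t k \<in> forms X 1" for k
      unfolding N'_def by (intro forms_add forms_scale forms)
  qed (rule in_G)
qed

text \<open>
  With \<open>\<delta> = \<Sum>card D - card X\<close> the numerical hypothesis reads \<open>\<delta> + m \<le> 2 e\<close>, so for \<open>\<delta> + m = 2 e\<close> it says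
  that \<open>x\<^sub>\<nu>\<^sup>m\<close> maps degree \<open>e - m\<close> of the quotient onto the opposite degree \<open>e\<close>. Both reductions keep it:
  dropping one factor from two generators lowers \<open>\<delta>\<close> by 2 and \<open>e\<close> by 1, and merging the two generators
  while dropping one factor and one variable leaves \<open>\<delta>\<close> as it is. The induction is on the total number
  of factors; an empty product is 1 and generates everything, so empty label sets end it.
\<close>

lemma exists_lefschetz_products:
  fixes Ds :: "'l set list"
  assumes inf: "infinite (UNIV :: 'k::field set)" and "finite X" "\<nu> \<in> X" "length Ds = card X"
    and "sorted_wrt (\<lambda>A B. A \<inter> B = {}) Ds" "\<And>D. D \<in> set Ds \<Longrightarrow> finite D"
    and "sum_list (map card Ds) + m \<le> 2 * e + card X"
  shows "\<exists>L :: 'l \<Rightarrow> 'k mpoly. (\<forall>k. L k \<in> forms X 1) \<and>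
    forms X e \<subseteq> idl.span (prod L ` set Ds \<union> {var \<nu> ^ m})"
  using assms(2-)
proof (induction "sum_list (map card Ds)" arbitrary: X Ds e rule: less_induct)
  case less
  show ?case
  proof (cases "{} \<in> set Ds")
    case True
    then have "1 \<in> prod (\<lambda>_. 0) ` set Ds \<union> {var \<nu> ^ m :: 'k mpoly}"
      by (auto intro!: image_eqI[of _ _ "{}"])
    then show ?thesis
      by (intro exI[of _ "\<lambda>_. 0"] conjI allI subsetI forms_zero ideal_with_one)
  next
    case nonempty: False
    obtain D1 Ds' where Ds': "Ds = D1 # Ds'"
      using less.prems(1,2,3) by (cases Ds) auto
    show ?thesis
    proof (cases Ds')
      case Nil
      then have "card X = 1" using less.prems(3) Ds' by simp
      then have X: "X = {\<nu>}" using less.prems(2) by (auto simp: card_1_singleton_iff)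
      have "card D1 \<le> e \<or> m \<le> e" using less.prems(6) Ds' Nil X by auto
      from lefschetz_one_variable[OF this, of \<nu>]
      show ?thesis
        using var_in_forms[of \<nu> X] by (intro exI[of _ "\<lambda>_. var \<nu>"]) (simp add: Ds' Nil X insert_commute)
    next
      case (Cons D2 Rs)
      note Ds = Ds'[unfolded Cons]
      have fin: "finite D1" "finite D2" "finite X" using less.prems Ds by auto
      obtain k1 k2 where k: "k1 \<in> D1" "k2 \<in> D2" using nonempty Ds by fastforce
      have disj: "D1 \<inter> D2 = {}" "\<And>D. D \<in> set Rs \<Longrightarrow> D1 \<inter> D = {} \<and> D2 \<inter> D = {}"
          "sorted_wrt (\<lambda>A B. A \<inter> B = {}) Rs"
        using less.prems(4) Ds by auto
      have "X \<noteq> {\<nu>}" using less.prems(3) Ds by auto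
      then obtain x where x: "x \<in> X" "x \<noteq> \<nu>" using less.prems(2) by blast
      have card: "card (D1 - {k1}) = card D1 - 1" "card (D2 - {k2}) = card D2 - 1"
          "card (D1 - {k1} \<union> D2) = card D1 - 1 + card D2" "card D1 > 0" "card D2 > 0"
          "card (X - {x}) = card X - 1" "card X > 0"
        using fin k x disj(1) card_Un_disjoint[of "D1 - {k1}" D2] by (auto simp: card_gt_0_iff)
      have IH1: "\<exists>L :: 'l \<Rightarrow> 'k mpoly. (\<forall>k. L k \<in> forms (X - {x}) 1) \<and>
          forms (X - {x}) e \<subseteq> idl.span (prod L ` set ((D1 - {k1} \<union> D2) # Rs) \<union> {var \<nu> ^ m})"
      proof (rule less.hyps)
        show "sum_list (map card ((D1 - {k1} \<union> D2) # Rs)) < sum_list (map card Ds)"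
          using card(3-5) by (simp add: Ds)
        show "length ((D1 - {k1} \<union> D2) # Rs) = card (X - {x})"
          using less.prems(3) card(6) by (simp add: Ds)
        show "sorted_wrt (\<lambda>A B. A \<inter> B = {}) ((D1 - {k1} \<union> D2) # Rs)"
          using disj(2,3) by auto
        show "sum_list (map card ((D1 - {k1} \<union> D2) # Rs)) + m \<le> 2 * e + card (X - {x})"
          using less.prems(6) card(3-7) by (simp add: Ds)
      qed (use fin less.prems(2,5) x in \<open>auto simp: Ds\<close>)
      then obtain L1 :: "'l \<Rightarrow> 'k mpoly" where L1: "\<And>k. L1 k \<in> forms (X - {x}) 1"
          "forms (X - {x}) e \<subseteq> idl.span (prod L1 ` insert (D1 - {k1} \<union> D2) (set Rs) \<union> {var \<nu> ^ m})"
        by auto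
      have L1': "forms X e \<subseteq>
          idl.span (prod L1 ` insert (D1 - {k1} \<union> D2) (set Rs) \<union> {var \<nu> ^ m, var x})" (is "_ \<subseteq> idl.span ?G")
      proof (rule forms_in_ideal_if_monomials)
        fix \<alpha> assume \<alpha>: "\<alpha> \<in> exps X e"
        show "mono_of \<alpha> \<in> idl.span ?G"
        proof (cases "x \<in> supp \<alpha>")
          case True
          then have "\<alpha> = (\<alpha> - Poly_Mapping.single x 1) + Poly_Mapping.single x 1"
            by (intro poly_mapping_eqI) (auto simp: lookup_add lookup_minus lookup_single when_def in_keys_iff)
          moreover have "mono_of (Poly_Mapping.single x 1) \<in> ?G" by (simp add: var_def)
          ultimately show ?thesis using mono_of_dvd by metis
        next
          case False
          then have "mono_of \<alpha> \<in> (forms (X - {x}) e :: 'k mpoly set)" using \<alpha> by (auto simp: exps_def)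
          then show ?thesis using L1(2) idl.span_mono[of "prod L1 ` insert (D1 - {k1} \<union> D2) (set Rs) \<union> {var \<nu> ^ m}" ?G] by blast
        qed
      qed
      have "\<exists>L2 :: 'l \<Rightarrow> 'k mpoly. (\<forall>k. L2 k \<in> forms X 1) \<and> (1 \<le> e \<longrightarrow> forms X (e - 1) \<subseteq>
          idl.span (prod L2 ` set ((D1 - {k1}) # (D2 - {k2}) # Rs) \<union> {var \<nu> ^ m}))"
      proof (cases "1 \<le> e")
        case True
        have "\<exists>L2 :: 'l \<Rightarrow> 'k mpoly. (\<forall>k. L2 k \<in> forms X 1) \<and> forms X (e - 1) \<subseteq>
          idl.span (prod L2 ` set ((D1 - {k1}) # (D2 - {k2}) # Rs) \<union> {var \<nu> ^ m})"
        proof (rule less.hyps)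
          show "sum_list (map card ((D1 - {k1}) # (D2 - {k2}) # Rs)) < sum_list (map card Ds)"
            using card(1,2,4,5) by (simp add: Ds)
          show "length ((D1 - {k1}) # (D2 - {k2}) # Rs) = card X"
            using less.prems(3) by (simp add: Ds)
          show "sorted_wrt (\<lambda>A B. A \<inter> B = {}) ((D1 - {k1}) # (D2 - {k2}) # Rs)"
            using disj by auto
          show "sum_list (map card ((D1 - {k1}) # (D2 - {k2}) # Rs)) + m \<le> 2 * (e - 1) + card X"
            using less.prems(6) card(1,2,4,5) True by (simp add: Ds)
        qed (use fin less.prems(2,5) in \<open>auto simp: Ds\<close>)
        then show ?thesis by blast
      qed (use forms_zero[of X 1] in auto)
      then obtain L2 :: "'l \<Rightarrow> 'k mpoly" where L2: "\<And>k. L2 k \<in> forms X 1"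
          "1 \<le> e \<Longrightarrow> forms X (e - 1) \<subseteq>
            idl.span (prod L2 ` insert (D1 - {k1}) (insert (D2 - {k2}) (set Rs)) \<union> {var \<nu> ^ m})"
        by auto
      have sep: "k1 \<notin> D2" "k2 \<notin> D1" "k1 \<notin> \<Union> (set Rs)" "k2 \<notin> \<Union> (set Rs)"
        using disj(1,2) k by blast+
      have "L1 k \<in> forms X 1" for k using L1(1) forms_mono[of "X - {x}" X] by blast
      from lefschetz_step[OF inf fin(3) x(1) less.prems(2) fin(1,2) k sep disj(1) this L1' L2]
      show ?thesis by (simp add: Ds)
    qed
  qed
qed

section \<open>Standard monomials of a homogeneous ideal\<close>

lemma coef_single_mult: "coef (Poly_Mapping.single \<gamma> c * p) (\<gamma> + \<beta>) = c * coef p \<beta>"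
  for p :: "'k::field mpoly"
proof -
  have "Poly_Mapping.single \<gamma> c * p = (\<Sum>\<alpha>\<in>supp p. Poly_Mapping.single (\<gamma> + \<alpha>) (c * coef p \<alpha>))"
    by (subst poly_eq_sum_single[of p]) (simp add: sum_distrib_left mult_single)
  then have "coef (Poly_Mapping.single \<gamma> c * p) (\<gamma> + \<beta>) =
      (\<Sum>\<alpha>\<in>supp p. if \<alpha> = \<beta> then c * coef p \<alpha> else 0)"
    by (simp add: lookup_sum lookup_single when_def)
  then show ?thesis by (simp add: in_keys_iff)
qed

lemma grevlex_less_add: "grevlex_less \<alpha> \<beta> \<Longrightarrow> grevlex_less (\<gamma> + \<alpha>) (\<gamma> + \<beta>)"
  by (auto simp: grevlex_less_def mdeg_add lookup_add)

lemma lead_exp_eqI: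
  assumes "\<alpha> \<in> supp p" "\<And>\<beta>. \<beta> \<in> supp p \<Longrightarrow> \<beta> \<noteq> \<alpha> \<Longrightarrow> grevlex_less \<beta> \<alpha>"
  shows "lead_exp p = \<alpha>"
proof (rule ccontr)
  assume ne: "lead_exp p \<noteq> \<alpha>"
  have "p \<noteq> 0" using assms(1) by auto
  then have "grevlex_less \<alpha> (lead_exp p)" "grevlex_less (lead_exp p) \<alpha>"
    using lead_exp[of p] assms ne by auto
  then show False using grevlex_less_trans grevlex_less_irrefl by blast
qed

lemma (in vector_space) independent_Un:
  assumes "independent A" "independent B" "span A \<inter> span B \<subseteq> {0}"
  shows "independent (A \<union> B)"
proof (unfold independent_explicit_finite_subsets, intro allI impI ballI)
  fix S u v assume S: "S \<subseteq> A \<union> B" "finite S" "(\<Sum>v\<in>S. scale (u v) v) = 0" and v: "v \<in> S"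
  define a where "a = (\<Sum>v\<in>S \<inter> A. scale (u v) v)"
  define b where "b = (\<Sum>v\<in>S - A. scale (u v) v)"
  have ab: "a + b = 0"
    using S(2,3) unfolding a_def b_def by (simp add: sum.Int_Diff[of S _ A])
  have "a \<in> span A" "b \<in> span B"
    unfolding a_def b_def using S(1) by (intro span_sum span_scale span_base; blast)+
  moreover have "a = - b" using ab by (simp only: eq_neg_iff_add_eq_0)
  ultimately have "a \<in> span A \<inter> span B" using span_neg[of b B] by simp
  then have a0: "a = 0" using assms(3) by blast
  with ab have b0: "b = 0" by simp
  show "u v = 0"
  proof (cases "v \<in> A")
    case True
    then show ?thesis
      using assms(1)[unfolded independent_explicit_finite_subsets, rule_format, of "S \<inter> A" u v]
        a0 S(2) v by (simp add: a_def)
  next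
    case False
    then show ?thesis
      using assms(2)[unfolded independent_explicit_finite_subsets, rule_format, of "S - A" u v]
        b0 S(1,2) v by (auto simp: b_def)
  qed
qed

lemma R_add: "p \<in> R n \<Longrightarrow> q \<in> R n \<Longrightarrow> p + q \<in> R n"
  using keys_add[of p q] unfolding R_def by blast

lemma R_mult:
  assumes "p \<in> R n" "q \<in> R n"
  shows "p * q \<in> R n"
  unfolding R_def
proof safe
  fix \<alpha> k assume "\<alpha> \<in> supp (p * q)" "k \<in> supp \<alpha>"
  moreover from this obtain \<beta> \<gamma> where "\<alpha> = \<beta> + \<gamma>" "\<beta> \<in> supp p" "\<gamma> \<in> supp q"
    using keys_mult[of p q] by blast
  ultimately have "k \<in> supp \<beta> \<union> supp \<gamma>" "supp \<beta> \<subseteq> {1..n}" "supp \<gamma> \<subseteq> {1..n}"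
    using assms unfolding R_def by (simp_all add: supp_add_nat)
  then show "k \<in> {1..n}" by blast
qed

lemma R_single: "supp \<alpha> \<subseteq> {1..n} \<Longrightarrow> Poly_Mapping.single \<alpha> c \<in> R n"
  by (simp add: R_def)

lemma R_zero: "0 \<in> R n"
  by (simp add: R_def)

lemma forms_R: "forms {1..n} e \<subseteq> R n"
  by (auto simp: forms_def R_def exps_def)

lemma ideal_gen_base: "s \<in> S \<Longrightarrow> s \<in> ideal_gen n S"
  unfolding ideal_gen_def
  by (rule CollectI, rule exI[of _ "{s}"], rule exI[of _ "\<lambda>_. 1"]) (auto simp: R_single simp flip: single_one)

lemma ideal_gen_zero: "0 \<in> ideal_gen n S"
  unfolding ideal_gen_def by (rule CollectI, rule exI[of _ "{}"]) simp

lemma ideal_gen_mult: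
  assumes "p \<in> ideal_gen n S" "r \<in> R n"
  shows "r * p \<in> ideal_gen n S"
proof -
  obtain T q where T: "p = (\<Sum>s\<in>T. q s * s)" "finite T" "T \<subseteq> S" "\<And>s. s \<in> T \<Longrightarrow> q s \<in> R n"
    using assms(1) unfolding ideal_gen_def by blast
  have "r * p = (\<Sum>s\<in>T. (r * q s) * s)" by (simp add: T(1) sum_distrib_left mult.assoc)
  then show ?thesis
    unfolding ideal_gen_def using T assms(2)
    by (intro CollectI exI[of _ T] exI[of _ "\<lambda>s. r * q s"]) (auto intro!: R_mult)
qed

lemma ideal_gen_add:
  assumes "p \<in> ideal_gen n S" "p' \<in> ideal_gen n S"
  shows "p + p' \<in> ideal_gen n S"
proof -
  obtain T q where T: "p = (\<Sum>s\<in>T. q s * s)" "finite T" "T \<subseteq> S" "\<And>s. s \<in> T \<Longrightarrow> q s \<in> R n"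
    using assms(1) unfolding ideal_gen_def by blast
  obtain T' q' where T': "p' = (\<Sum>s\<in>T'. q' s * s)" "finite T'" "T' \<subseteq> S" "\<And>s. s \<in> T' \<Longrightarrow> q' s \<in> R n"
    using assms(2) unfolding ideal_gen_def by blast
  define u where "u s = (if s \<in> T then q s else 0) + (if s \<in> T' then q' s else 0)" for s
  have "p = (\<Sum>s\<in>T \<union> T'. (if s \<in> T then q s else 0) * s)"
    unfolding T(1) using T(2) T'(2) by (intro sum.mono_neutral_cong_left) auto
  moreover have "p' = (\<Sum>s\<in>T \<union> T'. (if s \<in> T' then q' s else 0) * s)"
    unfolding T'(1) using T(2) T'(2) by (intro sum.mono_neutral_cong_left) auto
  ultimately have "p + p' = (\<Sum>s\<in>T \<union> T'. u s * s)"
    by (simp only: u_def distrib_right sum.distrib)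
  moreover have "u s \<in> R n" for s
    unfolding u_def using T(4) T'(4) by (auto intro!: R_add simp: R_zero)
  ultimately show ?thesis
    unfolding ideal_gen_def using T(2,3) T'(2,3)
    by (intro CollectI exI[of _ "T \<union> T'"] exI[of _ u]) auto
qed

lemma ideal_gen_subset_ideal: "ideal_gen n S \<subseteq> idl.span S"
proof
  fix p assume "p \<in> ideal_gen n S"
  then obtain T q where T: "p = (\<Sum>s\<in>T. q s * s)" "T \<subseteq> S"
    unfolding ideal_gen_def by blast
  then show "p \<in> idl.span S" by (auto intro!: idl.span_sum idl.span_scale intro: idl.span_base)
qed

lemma ideal_gen_supp:
  assumes "p \<in> ideal_gen n S" "\<alpha> \<in> supp p"
  obtains s \<beta> \<gamma> where "s \<in> S" "\<beta> \<in> supp s" "supp \<gamma> \<subseteq> {1..n}" "\<alpha> = \<gamma> + \<beta>"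
proof -
  obtain T q where T: "p = (\<Sum>s\<in>T. q s * s)" "T \<subseteq> S" "\<And>s. s \<in> T \<Longrightarrow> q s \<in> R n"
    using assms(1) unfolding ideal_gen_def by blast
  have "(\<Sum>s\<in>T. coef (q s * s) \<alpha>) \<noteq> 0"
    using assms(2) by (simp add: T(1) in_keys_iff lookup_sum)
  then obtain s where s: "s \<in> T" "coef (q s * s) \<alpha> \<noteq> 0"
    by (rule sum.not_neutral_contains_not_neutral)
  then have "\<alpha> \<in> supp (q s * s)" by (simp add: in_keys_iff)
  then obtain \<gamma> \<beta> where "\<alpha> = \<gamma> + \<beta>" "\<gamma> \<in> supp (q s)" "\<beta> \<in> supp s"
    using keys_mult[of "q s" s] by blast
  moreover have "supp \<gamma> \<subseteq> {1..n}" using T(3)[OF s(1)] \<open>\<gamma> \<in> supp (q s)\<close> by (simp add: R_def)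
  ultimately show thesis using that[of s \<beta> \<gamma>] s(1) T(2) by blast
qed

lemma ideal_gen_in_R:
  assumes "S \<subseteq> R n"
  shows "ideal_gen n S \<subseteq> R n"
proof
  fix p assume p: "p \<in> ideal_gen n S"
  have "supp \<alpha> \<subseteq> {1..n}" if \<alpha>: "\<alpha> \<in> supp p" for \<alpha>
  proof -
    obtain s \<beta> \<gamma> where "s \<in> S" "\<beta> \<in> supp s" "supp \<gamma> \<subseteq> {1..n}" "\<alpha> = \<gamma> + \<beta>"
      using ideal_gen_supp[OF p \<alpha>] by metis
    then show ?thesis using assms by (auto simp: R_def supp_add_nat)
  qed
  then show "p \<in> R n" by (simp add: R_def)
qed

definition standard_exps :: "nat \<Rightarrow> 'k::field mpoly set \<Rightarrow> nat \<Rightarrow> (nat \<Rightarrow>\<^sub>0 nat) set" where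
  "standard_exps n J e = {\<alpha> \<in> exps {1..n} e. mono_of \<alpha> \<notin> initial_ideal n J}"

lemma standard_monomials_eq: "standard_monomials n J e = mono_of ` standard_exps n J e"
  by (auto simp: standard_monomials_def standard_exps_def exponents_eq_exps)

lemma finite_standard_exps: "finite (standard_exps n J e)"
  by (simp add: standard_exps_def finite_exps)

text \<open>
  Closure under \<open>component\<close> is homogeneity: it makes the standard monomials of degree \<open>e\<close> depend only on
  the forms of degree \<open>e\<close> in \<open>J\<close>.
\<close>

locale homogeneous_ideal =
  fixes n :: nat and J :: "'k::field mpoly set"
  assumes zero: "0 \<in> J"
    and add: "p \<in> J \<Longrightarrow> q \<in> J \<Longrightarrow> p + q \<in> J"
    and mult: "p \<in> J \<Longrightarrow> q \<in> R n \<Longrightarrow> q * p \<in> J"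
    and in_R: "J \<subseteq> R n"
    and component: "p \<in> J \<Longrightarrow> component {1..n} e p \<in> J"
begin

lemma scale: "p \<in> J \<Longrightarrow> const c * p \<in> J"
  by (rule mult) (simp_all add: R_single)

lemma subspace: "vs.subspace J"
  using zero add scale by (simp add: vs.subspace_def)

lemma lead_exp_initial: "p \<in> J \<Longrightarrow> p \<noteq> 0 \<Longrightarrow> mono_of (lead_exp p) \<in> initial_ideal n J"
  unfolding initial_ideal_def by (rule ideal_gen_base) blast

text \<open>
  A monomial of the initial ideal is a monomial multiple of a leading monomial, hence itself the
  leading monomial of a member of \<open>J\<close>, of which the component of the right degree is kept.
\<close>

lemma initial_reduction:
  assumes "\<alpha> \<in> exps {1..n} e" "mono_of \<alpha> \<in> initial_ideal n J"
  obtains h where "h \<in> J \<inter> forms {1..n} e" "coef h \<alpha> = 1"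
    "\<And>\<beta>. \<beta> \<in> supp h \<Longrightarrow> \<beta> \<noteq> \<alpha> \<Longrightarrow> grevlex_less \<beta> \<alpha>"
proof -
  obtain p \<gamma> where p: "p \<in> J" "p \<noteq> 0" "supp \<gamma> \<subseteq> {1..n}" "\<alpha> = \<gamma> + lead_exp p"
  proof (rule ideal_gen_supp[OF assms(2)[unfolded initial_ideal_def], of \<alpha>])
    fix s \<beta> \<gamma> assume "s \<in> {mono_of (lead_exp p) | p. p \<in> J \<and> p \<noteq> 0}" "\<beta> \<in> supp s"
      "supp \<gamma> \<subseteq> {1..n}" "\<alpha> = \<gamma> + \<beta>"
    then show thesis using that by auto
  qed simp
  define h where "h = Poly_Mapping.single \<gamma> (1 / coef p (lead_exp p)) * p"
  have "coef p (lead_exp p) \<noteq> 0" using lead_exp(1)[OF p(2)] by (simp add: in_keys_iff)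
  then have 1: "coef h \<alpha> = 1" by (simp add: h_def p(4) coef_single_mult)
  have 2: "grevlex_less \<beta> \<alpha>" if \<beta>: "\<beta> \<in> supp h" "\<beta> \<noteq> \<alpha>" for \<beta>
  proof -
    obtain \<beta>' where "\<beta> = \<gamma> + \<beta>'" "\<beta>' \<in> supp p"
      using \<beta>(1) supp_single_mult unfolding h_def by blast
    then show ?thesis
      using lead_exp(2)[OF p(2), of \<beta>'] \<beta>(2) p(4) grevlex_less_add by auto
  qed
  have "h \<in> J" unfolding h_def using p by (intro mult R_single)
  show thesis
  proof (rule that[of "component {1..n} e h"])
    show "component {1..n} e h \<in> J \<inter> forms {1..n} e"
      using component[OF \<open>h \<in> J\<close>] component_in_forms by blast
    show "coef (component {1..n} e h) \<alpha> = 1"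
      using 1 assms(1) by (simp add: coef_component)
    show "grevlex_less \<beta> \<alpha>" if "\<beta> \<in> supp (component {1..n} e h)" "\<beta> \<noteq> \<alpha>" for \<beta>
      using that by (intro 2) (auto simp: in_keys_iff coef_component split: if_splits)
  qed
qed

text \<open>
  Division by \<open>J\<close>: a monomial that is not standard is congruent to a combination of smaller monomials of
  its degree, of which there are finitely many.
\<close>

lemma forms_reduce_to_standard:
  "forms {1..n} e \<subseteq> vs.span (mono_of ` standard_exps n J e \<union> J \<inter> forms {1..n} e)"
    (is "_ \<subseteq> vs.span ?S")
proof -
  have "mono_of \<alpha> \<in> vs.span ?S" if "\<alpha> \<in> exps {1..n} e" for \<alpha>
    using that
  proof (induction "card {\<beta> \<in> exps {1..n} e. grevlex_less \<beta> \<alpha>}" arbitrary: \<alpha> rule: less_induct)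
    case less
    show ?case
    proof (cases "mono_of \<alpha> \<in> initial_ideal n J")
      case False
      then have "mono_of \<alpha> \<in> ?S" using less.prems by (simp add: standard_exps_def)
      then show ?thesis by (rule vs.span_base)
    next
      case True
      then obtain h where h: "h \<in> J \<inter> forms {1..n} e" "coef h \<alpha> = 1"
          "\<And>\<beta>. \<beta> \<in> supp h \<Longrightarrow> \<beta> \<noteq> \<alpha> \<Longrightarrow> grevlex_less \<beta> \<alpha>"
        using initial_reduction[OF less.prems] by metis
      have lower: "mono_of \<beta> \<in> vs.span ?S" if \<beta>: "\<beta> \<in> supp h - {\<alpha>}" for \<beta>
      proof (rule less.hyps)
        have lt: "grevlex_less \<beta> \<alpha>" using h(3) \<beta> by simp
        show in_exps: "\<beta> \<in> exps {1..n} e" using h(1) \<beta> by (auto simp: forms_def)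
        show "card {\<beta>' \<in> exps {1..n} e. grevlex_less \<beta>' \<beta>} < card {\<beta> \<in> exps {1..n} e. grevlex_less \<beta> \<alpha>}"
        proof (rule psubset_card_mono)
          show "{\<beta>' \<in> exps {1..n} e. grevlex_less \<beta>' \<beta>} \<subset> {\<beta> \<in> exps {1..n} e. grevlex_less \<beta> \<alpha>}"
            using lt in_exps grevlex_less_irrefl[of \<beta>] grevlex_less_trans[of _ \<beta> \<alpha>] by blast
        qed (simp add: finite_exps)
      qed
      have "\<alpha> \<in> supp h" using h(2) by (simp add: in_keys_iff)
      then have "h = mono_of \<alpha> + (\<Sum>\<beta>\<in>supp h - {\<alpha>}. const (coef h \<beta>) * mono_of \<beta>)"
        using poly_eq_sum_mono[of h] h(2)
          sum.remove[of "supp h" \<alpha> "\<lambda>\<beta>. const (coef h \<beta>) * mono_of \<beta>"]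
        by (simp only: finite_keys single_one mult_1_left simp_thms)
      then have mono_eq: "mono_of \<alpha> = h - (\<Sum>\<beta>\<in>supp h - {\<alpha>}. const (coef h \<beta>) * mono_of \<beta>)"
        by (simp only: eq_diff_eq)
      show ?thesis
        unfolding mono_eq using h(1) lower by (intro vs.span_diff vs.span_sum vs.span_scale) (auto intro: vs.span_base)
    qed
  qed
  then show ?thesis unfolding forms_span[of "{1..n}" e] by (intro vs.span_minimal) auto
qed

lemma standard_span_inter:
  "vs.span (mono_of ` standard_exps n J e) \<inter> J \<subseteq> {0}"
proof safe
  fix p assume p: "p \<in> vs.span (mono_of ` standard_exps n J e)" "p \<in> J"
  have "vs.subspace {p :: 'k mpoly. supp p \<subseteq> standard_exps n J e}"
  proof -
    have "{p :: 'k mpoly. supp p \<subseteq> standard_exps n J e} = {p. \<forall>\<alpha>. \<alpha> \<notin> standard_exps n J e \<longrightarrow> coef p \<alpha> = 0}"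
      by (auto simp: in_keys_iff)
    then show ?thesis by (simp add: vs.subspace_def lookup_add)
  qed
  then have "vs.span (mono_of ` standard_exps n J e) \<subseteq> {p :: 'k mpoly. supp p \<subseteq> standard_exps n J e}"
    by (rule vs.span_minimal[rotated]) auto
  then have supp: "supp p \<subseteq> standard_exps n J e" using p(1) by blast
  show "p = 0"
  proof (rule ccontr)
    assume "p \<noteq> 0"
    then have "lead_exp p \<in> standard_exps n J e" "mono_of (lead_exp p) \<in> initial_ideal n J"
      using lead_exp(1)[of p] lead_exp_initial[OF p(2)] supp by blast+
    then show False by (simp add: standard_exps_def)
  qed
qed

text \<open>
  This lemma and the next say that the standard monomials of degree \<open>e\<close> are a basis of the degree \<open>e\<close>
  part of the quotient by \<open>J\<close>, as bounds on their number from below and from above.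
\<close>

lemma card_exps_le:
  assumes "J \<inter> forms {1..n} e \<subseteq> vs.span C" "finite C"
  shows "card (exps {1..n} e) \<le> card (standard_exps n J e) + card C"
proof -
  let ?B = "mono_of ` standard_exps n J e :: 'k mpoly set"
  have "J \<inter> forms {1..n} e \<subseteq> vs.span (?B \<union> C)"
    using assms(1) vs.span_mono[of C "?B \<union> C"] by blast
  then have "vs.span (?B \<union> J \<inter> forms {1..n} e) \<subseteq> vs.span (?B \<union> C)"
    by (intro vs.span_minimal) (auto intro: vs.span_base)
  then have "mono_of ` exps {1..n} e \<subseteq> vs.span (?B \<union> C)"
    using forms_reduce_to_standard[of e] mono_of_in_forms[of _ "{1..n}" e, THEN iffD2]
    by (meson image_subsetI subsetD)
  then have "card (mono_of ` exps {1..n} e :: 'k mpoly set) \<le> card (?B \<union> C)"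
    using vs.independent_span_bound[OF _ independent_mono_of, of "?B \<union> C" "exps {1..n} e"] assms(2)
    by (simp add: finite_standard_exps)
  also have "\<dots> \<le> card ?B + card C" by (rule card_Un_le)
  finally show ?thesis by (simp add: card_image[OF inj_mono_of])
qed

lemma card_standard_le:
  assumes "forms {1..n} e \<subseteq> vs.span (mono_of ` A \<union> J \<inter> forms {1..n} e)" "finite A"
  shows "card (standard_exps n J e) \<le> card A"
proof -
  let ?B = "mono_of ` standard_exps n J e :: 'k mpoly set"
  let ?E = "mono_of ` exps {1..n} e :: 'k mpoly set"
  obtain C where C: "C \<subseteq> J \<inter> forms {1..n} e" "vs.independent C" "J \<inter> forms {1..n} e \<subseteq> vs.span C"
    using vs.maximal_independent_subset by blast
  have finC: "finite C"
    using vs.independent_span_bound[OF _ C(2), of ?E] C(1) by (auto simp: forms_span finite_exps)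
  have "vs.span C \<subseteq> J" using C(1) by (intro vs.span_minimal subspace) auto
  then have int: "vs.span ?B \<inter> vs.span C \<subseteq> {0}" using standard_span_inter[of e] by blast
  then have ind: "vs.independent (?B \<union> C)"
    by (intro vs.independent_Un independent_mono_of C(2))
  have disj: "?B \<inter> C = {}"
  proof (rule equals0I)
    fix x assume x: "x \<in> ?B \<inter> C"
    then have "x \<in> vs.span ?B \<inter> vs.span C" by (intro IntI vs.span_base) simp_all
    then have "x = 0" using int by (simp add: subset_iff)
    then have "vs.dependent C" using x by (intro vs.dependent_zero) simp
    with C(2) show False by contradiction
  qed
  have "forms {1..n} e \<subseteq> vs.span (mono_of ` A \<union> C)"
  proof (rule order_trans[OF assms(1)], rule vs.span_minimal)
    show "mono_of ` A \<union> J \<inter> forms {1..n} e \<subseteq> vs.span (mono_of ` A \<union> C)"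
      using C(3) vs.span_mono[of C "mono_of ` A \<union> C"] vs.span_superset by blast
  qed simp
  moreover have "?B \<union> C \<subseteq> forms {1..n} e" using C(1) by (auto simp: standard_exps_def)
  ultimately have "card (?B \<union> C) \<le> card (mono_of ` A \<union> C)"
    using vs.independent_span_bound[OF _ ind, of "mono_of ` A \<union> C"] finC assms(2) by auto
  also have "\<dots> \<le> card (mono_of ` A :: 'k mpoly set) + card C" by (rule card_Un_le)
  also have "card (?B \<union> C) = card ?B + card C"
    using disj finC by (intro card_Un_disjoint) (auto simp: finite_standard_exps)
  finally show ?thesis by (simp add: card_image[OF inj_mono_of])
qed

text \<open>
  Here the order matters. If \<open>x\<^sup>\<alpha>\<close> is congruent modulo \<open>J\<close> to a form divisible by \<open>x\<^sub>n\<^sup>m\<close> and is not itself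
  divisible by \<open>x\<^sub>n\<^sup>m\<close>, then all terms of that form are smaller than \<open>x\<^sup>\<alpha>\<close>, because a larger exponent of the last
  variable makes a monomial smaller; so \<open>x\<^sup>\<alpha>\<close> is a leading monomial.
\<close>

lemma standard_divisible_by_last:
  assumes split: "\<And>p. p \<in> forms {1..n} e \<Longrightarrow>
      \<exists>r\<in>forms {1..n} e. p - r \<in> J \<and> (\<forall>\<beta>\<in>supp r. m \<le> coef \<beta> n)"
    and \<alpha>: "\<alpha> \<in> standard_exps n J e"
  shows "m \<le> coef \<alpha> n"
proof (rule ccontr)
  assume small: "\<not> m \<le> coef \<alpha> n"
  have in_exps: "\<alpha> \<in> exps {1..n} e" using \<alpha> by (simp add: standard_exps_def)
  then obtain r where r: "r \<in> forms {1..n} e" "mono_of \<alpha> - r \<in> J" "\<And>\<beta>. \<beta> \<in> supp r \<Longrightarrow> m \<le> coef \<beta> n"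
    using split[of "mono_of \<alpha>"] by auto
  let ?h = "mono_of \<alpha> - r"
  have "\<alpha> \<notin> supp r" using r(3) small by blast
  then have h\<alpha>: "\<alpha> \<in> supp ?h" by (simp add: in_keys_iff lookup_minus coef_mono_of)
  have "lead_exp ?h = \<alpha>"
  proof (rule lead_exp_eqI[OF h\<alpha>])
    fix \<beta> assume "\<beta> \<in> supp ?h" "\<beta> \<noteq> \<alpha>"
    then have \<beta>: "\<beta> \<in> supp r" by (auto simp: in_keys_iff lookup_minus coef_mono_of)
    then have "\<beta> \<in> exps {1..n} e" using r(1) by (auto simp: forms_def)
    moreover have "coef \<beta>' j = 0" if "\<beta>' \<in> exps {1..n} e" "n < j" for \<beta>' j
      using that by (auto simp: exps_def in_keys_iff)
    ultimately have "mdeg \<beta> = mdeg \<alpha>" "\<forall>j>n. coef \<beta> j = coef \<alpha> j"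
      using in_exps by (auto simp: exps_def)
    moreover have "coef \<alpha> n < coef \<beta> n" using r(3)[OF \<beta>] small by simp
    ultimately show "grevlex_less \<beta> \<alpha>" unfolding grevlex_less_def by blast
  qed
  moreover have "?h \<noteq> 0" using h\<alpha> by auto
  ultimately have "mono_of \<alpha> \<in> initial_ideal n J" using lead_exp_initial[OF r(2)] by simp
  with \<alpha> show False by (simp add: standard_exps_def)
qed

lemma standard_exps_divisor:
  assumes "\<gamma> + \<beta> \<in> standard_exps n J e"
  shows "\<beta> \<in> standard_exps n J (e - mdeg \<gamma>)"
proof -
  have *: "supp (\<gamma> + \<beta>) \<subseteq> {1..n}" "mdeg (\<gamma> + \<beta>) = e" "mono_of (\<gamma> + \<beta>) \<notin> initial_ideal n J"
    using assms by (auto simp: standard_exps_def exps_def)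
  have "mono_of \<beta> \<notin> initial_ideal n J"
  proof
    assume "mono_of \<beta> \<in> initial_ideal n J"
    then have "mono_of \<gamma> * mono_of \<beta> \<in> initial_ideal n J"
      unfolding initial_ideal_def using *(1)
      by (intro ideal_gen_mult) (auto simp: supp_add_nat mono_of_def simp del: One_nat_def intro: R_single)
    with *(3) show False by (simp add: mono_of_mult)
  qed
  then show ?thesis using * by (auto simp: standard_exps_def exps_def supp_add_nat mdeg_add)
qed

end

lemma homogeneous_ideal_gen:
  assumes "\<And>a. a \<in> A \<Longrightarrow> g a \<in> forms {1..n} (deg a)"
  shows "homogeneous_ideal n (ideal_gen n (g ` A))"
    and "p \<in> forms {1..n} e \<Longrightarrow> p \<in> ideal_gen n (g ` A) \<longleftrightarrow> p \<in> idl.span (g ` A)"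
proof -
  let ?J = "ideal_gen n (g ` A)"
  have scale: "const c * p \<in> ?J" if "p \<in> ?J" for c p
    using that by (intro ideal_gen_mult R_single) auto
  have sub: "vs.subspace ?J"
    by (simp add: vs.subspace_def ideal_gen_zero ideal_gen_add scale)
  have "vs.span ((\<lambda>(a, \<gamma>). mono_of \<gamma> * g a) ` multiples {1..n} e deg A) \<subseteq> ?J" for e
    by (intro vs.span_minimal sub)
      (auto simp: multiples_def exps_def mono_of_def simp del: One_nat_def intro!: ideal_gen_mult[OF ideal_gen_base] R_single)
  then have comp: "component {1..n} e p \<in> ?J" if "p \<in> idl.span (g ` A)" for e p
    using component_ideal[OF assms that] by blast
  show "homogeneous_ideal n ?J"
  proof
    show "?J \<subseteq> R n" using assms forms_R by (intro ideal_gen_in_R) blast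
    show "component {1..n} e p \<in> ?J" if "p \<in> ?J" for p e
      using comp that ideal_gen_subset_ideal by blast
  qed (auto simp: ideal_gen_zero ideal_gen_add ideal_gen_mult)
  show "p \<in> ?J \<longleftrightarrow> p \<in> idl.span (g ` A)" if "p \<in> forms {1..n} e"
    using comp[of p e] that ideal_gen_subset_ideal by (auto simp: component_form)
qed

section \<open>Box monomials\<close>

text \<open>Keeps the index sets \<open>{1..n}\<close> in the form in which the lemmas state them.\<close>

declare One_nat_def [simp del]

text \<open>
  For \<open>k = n\<close> these are the standard monomials of degree \<open>e\<close> of the ideal \<open>(x\<^sub>1\<^bsup>d 1\<^esup>, \<dots>, x\<^sub>n\<^bsup>d n\<^esup>)\<close>.
\<close>

definition box :: "nat \<Rightarrow> (nat \<Rightarrow> nat) \<Rightarrow> nat \<Rightarrow> nat \<Rightarrow> (nat \<Rightarrow>\<^sub>0 nat) set" where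
  "box n d k e = {\<alpha> \<in> exps {1..n} e. \<forall>l\<in>{1..k}. coef \<alpha> l < d l}"

text \<open>
  Multiplied by the \<open>j\<close>-th power \<open>x\<^sub>j\<^bsup>d j\<^esup>\<close>, the \<open>\<gamma>\<close> with \<open>(j, \<gamma>)\<close> in this set run once through the monomials
  of degree \<open>e\<close> outside the box, with \<open>j\<close> the first index at which the box is left.
\<close>

definition box_multiples :: "nat \<Rightarrow> (nat \<Rightarrow> nat) \<Rightarrow> nat \<Rightarrow> nat \<Rightarrow> (nat \<times> (nat \<Rightarrow>\<^sub>0 nat)) set" where
  "box_multiples n d k e = (SIGMA j:{j \<in> {1..k}. d j \<le> e}. box n d (j - 1) (e - d j))"

definition box_spanning :: "nat \<Rightarrow> (nat \<Rightarrow> nat) \<Rightarrow> (nat \<Rightarrow> 'k::field mpoly) \<Rightarrow> nat \<Rightarrow> nat \<Rightarrow> bool" where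
  "box_spanning n d f k e \<longleftrightarrow> forms {1..n} e \<subseteq>
     vs.span ((\<lambda>(j, \<gamma>). mono_of \<gamma> * f j) ` box_multiples n d k e \<union> mono_of ` box n d k e)"

lemma finite_box: "finite (box n d k e)"
  by (simp add: box_def finite_exps)

lemma finite_box_multiples: "finite (box_multiples n d k e)"
  by (auto simp: box_multiples_def finite_box)

lemma span_mult_transfer:
  assumes "\<And>s. s \<in> S \<Longrightarrow> s * x \<in> vs.span T" "q \<in> vs.span S"
  shows "q * x \<in> vs.span T"
  using assms(2)
proof (induction rule: vs.span_induct_alt)
  case (step c s y)
  show ?case
    using vs.span_add[OF vs.span_scale[OF assms(1)[OF step.hyps(1)], of c] step.IH]
    by (simp only: distrib_right mult.assoc)
qed (simp add: vs.span_zero)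

text \<open>
  The spanning sets rewrite every multiple of \<open>f j\<close> into box multiples. Expand the cofactor of \<open>f j\<close> by
  the spanning set for \<open>j - 1\<close>: its box monomials give box multiples of \<open>f j\<close>, and its terms \<open>x\<^sup>\<gamma> f l\<close> with
  \<open>l < j\<close> give \<open>(x\<^sup>\<gamma> f j) f l\<close>, a multiple of an earlier generator. This use of the trivial syzygies stands in
  for the regularity of the sequence \<open>f\<close>.
\<close>

lemma multiple_in_box_span:
  fixes f :: "nat \<Rightarrow> 'k::field mpoly"
  assumes f: "\<And>j. j \<in> {1..n} \<Longrightarrow> f j \<in> forms {1..n} (d j)"
    and spanning: "\<And>k e. k \<le> n \<Longrightarrow> box_spanning n d f k e"
    and "j \<in> {1..n}" "d j \<le> e" "p \<in> forms {1..n} (e - d j)"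
  shows "p * f j \<in> vs.span ((\<lambda>(j, \<gamma>). mono_of \<gamma> * f j) ` box_multiples n d j e)"
  using assms(3-)
proof (induction j arbitrary: e p rule: less_induct)
  case (less j)
  let ?S = "\<lambda>k e. (\<lambda>(j, \<gamma>). mono_of \<gamma> * f j) ` box_multiples n d k e"
  have "box_spanning n d f (j - 1) (e - d j)" using less.prems by (intro spanning) auto
  then have "p \<in> vs.span (?S (j - 1) (e - d j) \<union> mono_of ` box n d (j - 1) (e - d j))"
    using less.prems(3) unfolding box_spanning_def by (rule subsetD)
  then show ?case
  proof (rule span_mult_transfer[rotated])
    fix s assume "s \<in> ?S (j - 1) (e - d j) \<union> mono_of ` box n d (j - 1) (e - d j)"
    then consider l \<gamma> where "s = mono_of \<gamma> * f l" "(l, \<gamma>) \<in> box_multiples n d (j - 1) (e - d j)"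
      | \<gamma> where "s = mono_of \<gamma>" "\<gamma> \<in> box n d (j - 1) (e - d j)" by auto
    then show "s * f j \<in> vs.span (?S j e)"
    proof cases
      case 1
      then have l: "l < j" "l \<in> {1..n}" "d l \<le> e - d j" "\<gamma> \<in> exps {1..n} (e - d j - d l)"
        using less.prems(1) by (auto simp: box_multiples_def box_def)
      have "mono_of \<gamma> * f j \<in> forms {1..n} (e - d j - d l + d j)"
        using l(4) f[OF less.prems(1)] by (intro forms_mult) simp_all
      moreover have "e - d j - d l + d j = e - d l" using l(3) less.prems(2) by simp
      ultimately have "mono_of \<gamma> * f j * f l \<in> vs.span (?S l e)"
        using l less.prems(2) by (intro less.IH) auto
      moreover have "box_multiples n d l e \<subseteq> box_multiples n d j e"
        using l(1) by (auto simp: box_multiples_def)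
      ultimately have "mono_of \<gamma> * f j * f l \<in> vs.span (?S j e)"
        using vs.span_mono[OF image_mono] by blast
      then show ?thesis using 1(1) by (simp add: mult_ac)
    next
      case 2
      then have "(j, \<gamma>) \<in> box_multiples n d j e" using less.prems by (auto simp: box_multiples_def)
      then have "mono_of \<gamma> * f j \<in> ?S j e" by (rule rev_image_eqI) simp
      then show ?thesis using 2(1) by (simp add: vs.span_base)
    qed
  qed
qed

lemma card_box_multiples:
  "card (box_multiples n d n e) + card (box n d n e) \<le> card (exps {1..n} e)"
proof -
  let ?\<phi> = "\<lambda>(j, \<gamma>). \<gamma> + Poly_Mapping.single j (d j)"
  have mem: "l \<in> {1..n}" "coef \<gamma> k < d k \<or> \<not> (1 \<le> k \<and> k < l)"
      "\<gamma> + Poly_Mapping.single l (d l) \<in> exps {1..n} e"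
    if "(l, \<gamma>) \<in> box_multiples n d n e" for l \<gamma> k
    using that by (auto simp: box_multiples_def box_def exps_def mdeg_add supp_add_nat split: if_splits)
  have "inj_on ?\<phi> (box_multiples n d n e)"
  proof (rule inj_onI, clarify)
    fix j \<gamma> j' \<gamma>' assume *: "(j, \<gamma>) \<in> box_multiples n d n e" "(j', \<gamma>') \<in> box_multiples n d n e"
      and eq: "\<gamma> + Poly_Mapping.single j (d j) = \<gamma>' + Poly_Mapping.single j' (d j')"
    have c: "coef \<gamma> k + (if j = k then d j else 0) = coef \<gamma>' k + (if j' = k then d j' else 0)" for k
      using arg_cong[OF eq, of "\<lambda>\<alpha>. coef \<alpha> k"] by (simp add: lookup_add lookup_single when_def)
    have "j = j'"
      using c[of j] c[of j'] mem(1)[OF *(1)] mem(1)[OF *(2)] mem(2)[OF *(1), of j'] mem(2)[OF *(2), of j]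
      by (cases j j' rule: linorder_cases) auto
    with eq show "j = j' \<and> \<gamma> = \<gamma>'" by simp
  qed
  then have "card (box_multiples n d n e) = card (?\<phi> ` box_multiples n d n e)"
    by (simp add: card_image)
  moreover have "?\<phi> ` box_multiples n d n e \<inter> box n d n e = {}"
  proof (rule equals0I)
    fix \<alpha> assume "\<alpha> \<in> ?\<phi> ` box_multiples n d n e \<inter> box n d n e"
    then obtain j \<gamma> where j: "(j, \<gamma>) \<in> box_multiples n d n e"
        "\<gamma> + Poly_Mapping.single j (d j) \<in> box n d n e" by auto
    then have "coef (\<gamma> + Poly_Mapping.single j (d j)) j < d j" using mem(1) by (auto simp: box_def)
    then show False by (simp add: lookup_add)
  qed
  ultimately have "card (box_multiples n d n e) + card (box n d n e) =
      card (?\<phi> ` box_multiples n d n e \<union> box n d n e)"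
    using finite_box_multiples finite_box by (simp add: card_Un_disjoint)
  also have "\<dots> \<le> card (exps {1..n} e)"
    using mem(3) by (intro card_mono) (auto simp: finite_exps box_def)
  finally show ?thesis .
qed

text \<open>
  The reflection \<open>\<alpha>\<^sub>j \<mapsto> d\<^sub>j - 1 - \<alpha>\<^sub>j\<close> of the box.
\<close>

lemma card_box_symmetric:
  assumes "\<And>j. j \<in> {1..n} \<Longrightarrow> 1 \<le> d j" "i \<le> (\<Sum>j=1..n. d j) - n"
  shows "card (box n d n i) \<le> card (box n d n ((\<Sum>j=1..n. d j) - n - i))"
proof -
  define \<phi> where "\<phi> \<alpha> = (\<Sum>j=1..n. Poly_Mapping.single j (d j - 1 - coef \<alpha> j))" for \<alpha> :: "nat \<Rightarrow>\<^sub>0 nat"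
  have coef: "coef (\<phi> \<alpha>) j = (if j \<in> {1..n} then d j - 1 - coef \<alpha> j else 0)" for \<alpha> j
    by (simp add: \<phi>_def lookup_sum lookup_single when_def)
  have supp: "supp (\<phi> \<alpha>) \<subseteq> {1..n}" for \<alpha>
    by (auto simp: in_keys_iff coef split: if_splits)
  have "\<phi> ` box n d n i \<subseteq> box n d n ((\<Sum>j=1..n. d j) - n - i)"
  proof
    fix \<beta> assume "\<beta> \<in> \<phi> ` box n d n i"
    then obtain \<alpha> where \<alpha>: "\<alpha> \<in> box n d n i" "\<beta> = \<phi> \<alpha>" by blast
    have le: "coef \<alpha> j \<le> d j - 1" "1 \<le> d j" if "j \<in> {1..n}" for j
      using \<alpha>(1) that assms(1)[OF that] by (force simp: box_def)+
    have "mdeg \<beta> = (\<Sum>j=1..n. (d j - 1) - coef \<alpha> j)"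
      unfolding \<alpha>(2) by (subst mdeg_eq_sum[OF _ supp]) (simp_all add: coef)
    also have "\<dots> = (\<Sum>j=1..n. d j - 1) - (\<Sum>j=1..n. coef \<alpha> j)"
      using le(1) by (intro sum_subtractf_nat) auto
    also have "(\<Sum>j=1..n. coef \<alpha> j) = i"
      using \<alpha>(1) mdeg_eq_sum[of "{1..n}" \<alpha>] by (auto simp: box_def exps_def)
    also have "(\<Sum>j=1..n. d j - 1) = (\<Sum>j=1..n. d j) - n"
      using le(2) by (subst sum_subtractf_nat) auto
    finally have "\<beta> \<in> exps {1..n} ((\<Sum>j=1..n. d j) - n - i)"
      using supp[of \<alpha>] \<alpha>(2) by (simp add: exps_def)
    moreover have "coef \<beta> j < d j" if "j \<in> {1..n}" for j
      using le(2)[OF that] that by (simp add: \<alpha>(2) coef)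
    ultimately show "\<beta> \<in> box n d n ((\<Sum>j=1..n. d j) - n - i)" by (simp add: box_def)
  qed
  moreover have "inj_on \<phi> (box n d n i)"
  proof (rule inj_onI, rule poly_mapping_eqI)
    fix \<alpha> \<beta> j assume *: "\<alpha> \<in> box n d n i" "\<beta> \<in> box n d n i" "\<phi> \<alpha> = \<phi> \<beta>"
    show "coef \<alpha> j = coef \<beta> j"
    proof (cases "j \<in> {1..n}")
      case True
      then have "coef \<alpha> j < d j" "coef \<beta> j < d j" using *(1,2) by (auto simp: box_def)
      moreover have "d j - 1 - coef \<alpha> j = d j - 1 - coef \<beta> j"
        using coef[of \<alpha> j] coef[of \<beta> j] *(3) True by simp
      ultimately show ?thesis by linarith
    next
      case False
      then have "j \<notin> supp \<alpha>" "j \<notin> supp \<beta>" using *(1,2) by (auto simp: box_def exps_def)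
      then show ?thesis by (simp add: in_keys_iff)
    qed
  qed
  ultimately show ?thesis by (metis card_inj_on_le finite_box)
qed

text \<open>
  In degree \<open>e\<close> the ideal is spanned by box multiples, and box multiples and box monomials together are
  at most as many as all monomials; so the quotient has at least the dimension that the box monomials
  suggest. It has no larger one, since the box monomials span it.
\<close>

lemma card_standard_exps_eq_box:
  fixes f :: "nat \<Rightarrow> 'k::field mpoly"
  assumes f: "\<And>j. j \<in> {1..n} \<Longrightarrow> f j \<in> forms {1..n} (d j)"
    and spanning: "\<And>k e. k \<le> n \<Longrightarrow> box_spanning n d f k e"
  shows "card (standard_exps n (ideal_gen n (f ` {1..n})) e) = card (box n d n e)"
proof -
  let ?J = "ideal_gen n (f ` {1..n})"
  let ?S = "(\<lambda>(j, \<gamma>). mono_of \<gamma> * f j) ` box_multiples n d n e"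
  interpret homogeneous_ideal n ?J
    using homogeneous_ideal_gen(1)[of "{1..n}" f n d] f by blast
  have in_J: "p \<in> ?J \<longleftrightarrow> p \<in> idl.span (f ` {1..n})" if "p \<in> forms {1..n} e" for p
    using homogeneous_ideal_gen(2)[of "{1..n}" f n d p e] f that by blast
  have S_eq: "?S \<subseteq> ?J \<inter> forms {1..n} e"
  proof
    fix s assume "s \<in> ?S"
    then obtain j \<gamma> where s: "s = mono_of \<gamma> * f j" "j \<in> {1..n}" "d j \<le> e" "\<gamma> \<in> exps {1..n} (e - d j)"
      by (auto simp: box_multiples_def box_def)
    have "s \<in> forms {1..n} (e - d j + d j)"
      unfolding s(1) using s f by (intro forms_mult) simp_all
    then have "s \<in> forms {1..n} e" using s(3) by simp
    moreover have "s \<in> idl.span (f ` {1..n})"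
      unfolding s(1) using s(2) by (intro idl.span_scale idl.span_base) simp
    ultimately show "s \<in> ?J \<inter> forms {1..n} e" using in_J by blast
  qed
  have "?J \<inter> forms {1..n} e \<subseteq> vs.span ?S"
  proof
    fix p assume p: "p \<in> ?J \<inter> forms {1..n} e"
    then have "p \<in> vs.span ((\<lambda>(a, \<gamma>). mono_of \<gamma> * f a) ` multiples {1..n} e d {1..n})"
      using forms_inter_ideal[of "{1..n}" f "{1..n}" d p e] f in_J by blast
    moreover have "mono_of \<gamma> * f j \<in> vs.span ?S"
      if jg: "(j, \<gamma>) \<in> multiples {1..n} e d {1..n}" for j \<gamma>
    proof -
      have j: "j \<in> {1..n}" "d j \<le> e" "\<gamma> \<in> exps {1..n} (e - d j)"
        using jg by (auto simp: multiples_def)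
      have "mono_of \<gamma> * f j \<in> vs.span ((\<lambda>(j, \<gamma>). mono_of \<gamma> * f j) ` box_multiples n d j e)"
        by (rule multiple_in_box_span[OF f spanning j(1,2)]) (use j(3) in simp_all)
      moreover have "box_multiples n d j e \<subseteq> box_multiples n d n e"
        using j(1) by (auto simp: box_multiples_def)
      ultimately show ?thesis using vs.span_mono[OF image_mono] by blast
    qed
    then have "vs.span ((\<lambda>(a, \<gamma>). mono_of \<gamma> * f a) ` multiples {1..n} e d {1..n}) \<subseteq> vs.span ?S"
      by (intro vs.span_minimal image_subsetI) auto
    ultimately show "p \<in> vs.span ?S" by blast
  qed
  then have "card (exps {1..n} e) \<le> card (standard_exps n ?J e) + card ?S"
    using finite_box_multiples by (intro card_exps_le) simp_all
  also have "card ?S \<le> card (box_multiples n d n e)"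
    by (rule card_image_le[OF finite_box_multiples])
  finally have "card (box n d n e) \<le> card (standard_exps n ?J e)"
    using card_box_multiples[of n d e] by simp
  moreover have "card (standard_exps n ?J e) \<le> card (box n d n e)"
  proof (rule card_standard_le[OF _ finite_box])
    have "?S \<union> mono_of ` box n d n e \<subseteq> mono_of ` box n d n e \<union> ?J \<inter> forms {1..n} e"
      using S_eq by blast
    from vs.span_mono[OF this]
    show "forms {1..n} e \<subseteq> vs.span (mono_of ` box n d n e \<union> ?J \<inter> forms {1..n} e)"
      using spanning[of n e] unfolding box_spanning_def by (meson order_refl order_trans)
  qed
  ultimately show ?thesis by simp
qed

text \<open>
  For the powers of the variables the spanning set consists of all the monomials of degree \<open>e\<close>.
\<close>

lemma box_spanning_powers:
  "box_spanning n d (\<lambda>j. mono_of (Poly_Mapping.single j (d j)) :: 'k::field mpoly) k e"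
  if "k \<le> n"
  unfolding box_spanning_def forms_span[of _ e]
proof (rule vs.span_mono, rule image_subsetI)
  fix \<alpha> assume \<alpha>: "\<alpha> \<in> exps {1..n} e"
  let ?S = "(\<lambda>(j, \<gamma>). mono_of \<gamma> * mono_of (Poly_Mapping.single j (d j)) :: 'k mpoly) ` box_multiples n d k e"
  show "mono_of \<alpha> \<in> ?S \<union> mono_of ` box n d k e"
  proof (cases "\<alpha> \<in> box n d k e")
    case False
    define j where "j = (LEAST j. j \<in> {1..k} \<and> d j \<le> coef \<alpha> j)"
    have "\<exists>j. j \<in> {1..k} \<and> d j \<le> coef \<alpha> j" using False \<alpha> by (auto simp: box_def not_less)
    then have j: "j \<in> {1..k}" "d j \<le> coef \<alpha> j" unfolding j_def by (metis (mono_tags, lifting) LeastI_ex)+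
    have least: "coef \<alpha> l < d l" if l: "l \<in> {1..j - 1}" for l
    proof -
      have "l < j" "l \<in> {1..k}" using l j(1) by auto
      then show ?thesis
        using not_less_Least[of l "\<lambda>j. j \<in> {1..k} \<and> d j \<le> coef \<alpha> j", folded j_def] by auto
    qed
    define \<gamma> where "\<gamma> = \<alpha> - Poly_Mapping.single j (d j)"
    have \<gamma>: "\<gamma> + Poly_Mapping.single j (d j) = \<alpha>"
      using j(2) by (intro poly_mapping_eqI) (auto simp: \<gamma>_def lookup_add lookup_minus lookup_single when_def)
    have "Poly_Mapping.single j (d j) \<in> exps {1..n} (d j)"
      using j(1) that by (auto simp: exps_def)
    then have "d j \<le> e" "\<gamma> \<in> exps {1..n} (e - d j)"
      using add_mem_exps_iff[of "Poly_Mapping.single j (d j)" "{1..n}" "d j" \<gamma> e] \<alpha> \<gamma> by auto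
    moreover have "coef \<gamma> l < d l" if "l \<in> {1..j - 1}" for l
      using least[OF that] that by (auto simp: \<gamma>_def lookup_minus)
    ultimately have "(j, \<gamma>) \<in> box_multiples n d k e"
      using j(1) by (auto simp: box_multiples_def box_def)
    then show ?thesis
      by (intro UnI1 rev_image_eqI) (auto simp: mono_of_mult \<gamma>)
  qed simp
qed

section \<open>Generic coefficients\<close>

definition monomial_value :: "('i \<Rightarrow> 'k::field) \<Rightarrow> ('i \<Rightarrow>\<^sub>0 nat) \<Rightarrow> 'k" where
  "monomial_value c m = (\<Prod>v\<in>supp m. c v ^ coef m v)"

lemma monomial_value_superset:
  assumes "finite V" "supp m \<subseteq> V"
  shows "monomial_value c m = (\<Prod>v\<in>V. c v ^ coef m v)"
  unfolding monomial_value_def using assms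
  by (intro prod.mono_neutral_left) (auto simp: in_keys_iff)

lemma monomial_value_add: "monomial_value c (m + m') = monomial_value c m * monomial_value c m'"
proof -
  have "supp (m + m') \<subseteq> supp m \<union> supp m'" by (rule keys_add)
  then show ?thesis
    by (simp add: monomial_value_superset[of "supp m \<union> supp m'"] lookup_add power_add prod.distrib)
qed

lemma poly_eval_superset:
  assumes "finite A" "supp P \<subseteq> A"
  shows "poly_eval c P = (\<Sum>m\<in>A. coef P m * monomial_value c m)"
  unfolding poly_eval_def monomial_value_def[symmetric] using assms
  by (intro sum.mono_neutral_left) (auto simp: in_keys_iff)

lemma poly_eval_diff: "poly_eval c (P - Q) = poly_eval c P - poly_eval c Q"
proof -
  have "supp (P - Q) \<subseteq> supp P \<union> supp Q"
    by (auto simp: in_keys_iff lookup_minus)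
  then show ?thesis
    by (simp add: poly_eval_superset[of "supp P \<union> supp Q"] lookup_minus left_diff_distrib sum_subtractf)
qed

lemma poly_eval_sum: "poly_eval c (sum P A) = (\<Sum>a\<in>A. poly_eval c (P a))"
proof (induction A rule: infinite_finite_induct)
  case (insert a A)
  have "poly_eval c (P a + sum P A) = poly_eval c (P a) - poly_eval c (0 - sum P A)"
    by (simp flip: poly_eval_diff)
  then show ?case using insert by (simp only: poly_eval_diff) (simp add: poly_eval_def)
qed (simp_all add: poly_eval_def)

lemma poly_eval_single: "poly_eval c (Poly_Mapping.single m a) = a * monomial_value c m"
  by (simp add: poly_eval_superset[of "{m}"])

lemma mult_eq_sum_single:
  fixes P Q :: "('a::cancel_comm_monoid_add \<Rightarrow>\<^sub>0 'k::field)"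
  shows "P * Q = (\<Sum>m\<in>supp P. \<Sum>m'\<in>supp Q. Poly_Mapping.single (m + m') (coef P m * coef Q m'))"
proof -
  have expand: "P = (\<Sum>m\<in>supp P. Poly_Mapping.single m (coef P m))" for P :: "'a \<Rightarrow>\<^sub>0 'k"
    by (rule poly_mapping_eqI) (auto simp: lookup_sum lookup_single when_def in_keys_iff)
  show ?thesis
    by (subst expand[of P], subst expand[of Q]) (simp only: sum_product mult_single)
qed

lemma poly_eval_mult: "poly_eval c (P * Q) = poly_eval c P * poly_eval c Q"
proof -
  have "poly_eval c P = (\<Sum>m\<in>supp P. coef P m * monomial_value c m)" for P
    by (rule poly_eval_superset) simp_all
  then show ?thesis
    by (simp add: mult_eq_sum_single poly_eval_sum poly_eval_single monomial_value_add sum_product mult_ac)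
qed

definition polys_over :: "'k::field set \<Rightarrow> 'i set \<Rightarrow> (('i \<Rightarrow>\<^sub>0 nat) \<Rightarrow>\<^sub>0 'k) set" where
  "polys_over F I = {P. \<forall>m\<in>supp P. coef P m \<in> F \<and> supp m \<subseteq> I}"

lemma polys_over_single:
  assumes "a \<in> F" "supp m \<subseteq> I"
  shows "Poly_Mapping.single m a \<in> polys_over F I"
  using assms by (simp add: polys_over_def)

lemma polys_over_diff:
  assumes "is_subfield F" "P \<in> polys_over F I" "Q \<in> polys_over F I"
  shows "P - Q \<in> polys_over F I"
proof -
  have zero: "0 \<in> F" and diff: "\<And>a b. a \<in> F \<Longrightarrow> b \<in> F \<Longrightarrow> a - b \<in> F"
    using assms(1) by (auto simp: is_subfield_def)
  have "coef P m \<in> F" "coef Q m \<in> F" for m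
    using assms(2,3) zero unfolding polys_over_def
    by (cases "m \<in> supp P"; cases "m \<in> supp Q"; auto simp: in_keys_iff)+
  then have "coef (P - Q) m \<in> F" for m
    by (simp add: lookup_minus diff)
  moreover have "supp (P - Q) \<subseteq> supp P \<union> supp Q" by (auto simp: in_keys_iff lookup_minus)
  moreover have "supp m \<subseteq> I" if "m \<in> supp P \<union> supp Q" for m
    using that assms(2,3) by (auto simp: polys_over_def)
  ultimately show ?thesis unfolding polys_over_def by blast
qed

lemma polys_over_zero: "0 \<in> polys_over F I"
  by (simp add: polys_over_def)

lemma polys_over_sum:
  assumes "is_subfield F" "\<And>a. a \<in> A \<Longrightarrow> P a \<in> polys_over F I"
  shows "sum P A \<in> polys_over F I"
  using assms(2)
proof (induction A rule: infinite_finite_induct)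
  case (insert a A)
  then have "P a - (0 - sum P A) \<in> polys_over F I"
    by (intro polys_over_diff[OF assms(1)] polys_over_zero) auto
  then show ?case using insert by simp
qed (simp_all add: polys_over_zero)

lemma polys_over_mult:
  assumes "is_subfield F" "P \<in> polys_over F I" "Q \<in> polys_over F I"
  shows "P * Q \<in> polys_over F I"
  unfolding mult_eq_sum_single
proof (intro polys_over_sum[OF assms(1)] polys_over_single)
  fix m m' assume m: "m \<in> supp P" "m' \<in> supp Q"
  then show "coef P m * coef Q m' \<in> F"
    using assms by (simp add: polys_over_def is_subfield_def)
  have "supp m \<subseteq> I" "supp m' \<subseteq> I" using m assms by (auto simp: polys_over_def)
  then show "supp (m + m') \<subseteq> I" using keys_add[of m m'] by blast
qed

definition coefficient_functions :: "'k::field set \<Rightarrow> 'i set \<Rightarrow> (('i \<Rightarrow> 'k) \<Rightarrow> 'k) set" where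
  "coefficient_functions F I = (\<lambda>P c. poly_eval c P) ` polys_over F I"

lemma function_ring_coefficients:
  assumes "is_subfield F"
  shows "function_ring (coefficient_functions F I)"
proof
  have "1 \<in> F" using assms by (simp add: is_subfield_def)
  then have "Poly_Mapping.single 0 1 \<in> polys_over F I" by (intro polys_over_single) auto
  then show "(\<lambda>_. 1) \<in> coefficient_functions F I"
    unfolding coefficient_functions_def
    by (rule rev_image_eqI) (simp add: poly_eval_single monomial_value_def flip: single_one)
  fix f g :: "('b \<Rightarrow> 'a) \<Rightarrow> 'a"
  assume "f \<in> coefficient_functions F I" "g \<in> coefficient_functions F I"
  then obtain P Q where PQ: "P \<in> polys_over F I" "Q \<in> polys_over F I"
      "f = (\<lambda>c. poly_eval c P)" "g = (\<lambda>c. poly_eval c Q)"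
    unfolding coefficient_functions_def by blast
  show "(\<lambda>c. f c - g c) \<in> coefficient_functions F I"
    unfolding coefficient_functions_def
    by (rule rev_image_eqI[OF polys_over_diff[OF assms PQ(1,2)]]) (simp add: PQ poly_eval_diff)
  show "(\<lambda>c. f c * g c) \<in> coefficient_functions F I"
    unfolding coefficient_functions_def
    by (rule rev_image_eqI[OF polys_over_mult[OF assms PQ(1,2)]]) (simp add: PQ poly_eval_mult)
qed

lemma coordinate_function:
  assumes "is_subfield F" "v \<in> I"
  shows "(\<lambda>c. c v) \<in> coefficient_functions F I"
proof -
  have "Poly_Mapping.single (Poly_Mapping.single v 1) 1 \<in> polys_over F I"
    using assms by (intro polys_over_single) (auto simp: is_subfield_def)
  then show ?thesis
    unfolding coefficient_functions_def
    by (rule rev_image_eqI) (simp add: poly_eval_single monomial_value_def)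
qed

text \<open>
  A function with coefficients in \<open>F\<close> that is nonzero at one point, with any coordinates in the
  whole field, comes from a nonzero polynomial and so is nonzero at algebraically independent coordinates.
\<close>

lemma generic_nonzero:
  assumes "alg_independent F I c" "D \<in> coefficient_functions F I" "D c0 \<noteq> 0"
  shows "D c \<noteq> 0"
proof
  assume 0: "D c = 0"
  obtain P where P: "P \<in> polys_over F I" "D = (\<lambda>c. poly_eval c P)"
    using assms(2) unfolding coefficient_functions_def by blast
  then have "P = 0"
    using assms(1) 0 unfolding alg_independent_def polys_over_def by simp
  then show False using assms(3) P(2) by (simp add: poly_eval_def)
qed

locale generic_forms =
  fixes F :: "'k::field set" and n :: nat and d :: "nat \<Rightarrow> nat"
    and c :: "nat \<times> (nat \<Rightarrow>\<^sub>0 nat) \<Rightarrow> 'k"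
  assumes subfield: "is_subfield F"
    and generic: "alg_independent F (SIGMA j:{1..n}. exps {1..n} (d j)) c"
begin

sublocale function_ring "coefficient_functions F (SIGMA j:{1..n}. exps {1..n} (d j))"
  by (rule function_ring_coefficients[OF subfield])

text \<open>
  A function of an arbitrary coefficient vector, so that the generic form, its value at \<open>c\<close>, can be compared
  with its other specialisations.
\<close>

definition general_form :: "nat \<Rightarrow> (nat \<times> (nat \<Rightarrow>\<^sub>0 nat) \<Rightarrow> 'k) \<Rightarrow> 'k mpoly" where
  "general_form j b = (\<Sum>\<alpha>\<in>exps {1..n} (d j). Poly_Mapping.single \<alpha> (b (j, \<alpha>)))"

lemma coef_general_form:
  "coef (general_form j b) \<alpha> = (if \<alpha> \<in> exps {1..n} (d j) then b (j, \<alpha>) else 0)"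
  by (simp add: general_form_def lookup_sum lookup_single when_def finite_exps)

lemma family_general_form:
  assumes "j \<in> {1..n}"
  shows "family {1..n} (d j) (general_form j)"
proof -
  have "(\<lambda>c. coef (general_form j c) \<alpha>) \<in> coefficient_functions F (SIGMA j:{1..n}. exps {1..n} (d j))" for \<alpha>
    using assms zero by (cases "\<alpha> \<in> exps {1..n} (d j)")
      (auto simp: coef_general_form simp del: One_nat_def intro!: coordinate_function[OF subfield])
  then show ?thesis by (simp add: family_def forms_iff_coef coef_general_form)
qed

lemma general_form_attains:
  fixes f :: "nat \<Rightarrow> 'k mpoly"
  assumes "\<And>j. j \<in> {1..n} \<Longrightarrow> f j \<in> forms {1..n} (d j)"
  obtains c0 where "\<And>j. j \<in> {1..n} \<Longrightarrow> general_form j c0 = f j"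
proof
  fix j assume "j \<in> {1..n}"
  then show "general_form j (\<lambda>(j, \<alpha>). coef (f j) \<alpha>) = f j"
    using assms[of j] by (intro poly_mapping_eqI) (auto simp: coef_general_form forms_iff_coef)
qed

lemma generic_ideal_contains_forms:
  fixes f :: "nat \<Rightarrow> 'k mpoly"
  assumes f: "\<And>j. j \<in> {1..n} \<Longrightarrow> f j \<in> forms {1..n} (d j)" and \<beta>: "\<beta> \<in> exps {1..n} m"
    and "forms {1..n} e \<subseteq> idl.span (insert (mono_of \<beta>) (f ` {1..n}))"
  shows "forms {1..n} e \<subseteq> idl.span (insert (mono_of \<beta>) ((\<lambda>j. general_form j c) ` {1..n}))"
proof -
  obtain c0 where c0: "\<And>j. j \<in> {1..n} \<Longrightarrow> general_form j c0 = f j"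
    using general_form_attains[OF f] by metis
  define g where "g a b = (case a of None \<Rightarrow> mono_of \<beta> | Some j \<Rightarrow> general_form j b)" for a b
  let ?A = "insert None (Some ` {1..n})"
  have im: "(\<lambda>a. g a b) ` ?A = insert (mono_of \<beta>) ((\<lambda>j. general_form j b) ` {1..n})" for b
    by (simp add: g_def image_image)
  have "(\<lambda>j. general_form j c0) ` {1..n} = f ` {1..n}" using c0 by (rule image_cong[OF refl])
  then have "forms {1..n} e \<subseteq> idl.span ((\<lambda>a. g a c0) ` ?A)" using assms(3) im by simp
  moreover have "family {1..n} (case_option m d a) (g a)" if "a \<in> ?A" for a
    using that family_general_form family_mono_of[OF \<beta>]
    by (auto simp: g_def [abs_def])
  ultimately obtain D where
      "D \<in> coefficient_functions F (SIGMA j:{1..n}. exps {1..n} (d j))" "D c0 \<noteq> 0"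
      "\<And>b. D b \<noteq> 0 \<Longrightarrow> forms {1..n} e \<subseteq> idl.span ((\<lambda>a. g a b) ` ?A)"
    using ideal_open[of "{1..n}" ?A "case_option m d" g e c0] by blast
  then show ?thesis using generic_nonzero[OF generic] im by metis
qed

text \<open>
  Specialise the generic forms to the powers of the variables.
\<close>

lemma generic_box_spanning:
  assumes "k \<le> n"
  shows "box_spanning n d (\<lambda>j. general_form j c) k e"
proof -
  define f where "f j = (mono_of (Poly_Mapping.single j (d j)) :: 'k mpoly)" for j
  have "f j \<in> forms {1..n} (d j)" if "j \<in> {1..n}" for j
    using that by (auto simp: f_def exps_def)
  then obtain c0 where c0: "\<And>j. j \<in> {1..n} \<Longrightarrow> general_form j c0 = f j"
    using general_form_attains by metis
  define v where "v a b = (case a of Inl (j, \<gamma>) \<Rightarrow> mono_of \<gamma> * general_form j b | Inr \<gamma> \<Rightarrow> mono_of \<gamma>)" for a b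
  let ?A = "Inl ` box_multiples n d k e \<union> Inr ` box n d k e"
  have im: "(\<lambda>a. v a b) ` ?A =
      (\<lambda>(j, \<gamma>). mono_of \<gamma> * general_form j b) ` box_multiples n d k e \<union> mono_of ` box n d k e" for b
    by (simp add: v_def image_Un image_image)
  have "(\<lambda>(j, \<gamma>). mono_of \<gamma> * general_form j c0) ` box_multiples n d k e =
      (\<lambda>(j, \<gamma>). mono_of \<gamma> * f j) ` box_multiples n d k e"
    using c0 assms by (intro image_cong) (auto simp: box_multiples_def)
  then have "forms {1..n} e \<subseteq> vs.span ((\<lambda>a. v a c0) ` ?A)"
    using box_spanning_powers[OF assms, of d e, where ?'k = 'k] unfolding im box_spanning_def f_def by simp
  moreover have "family {1..n} e (v a)" if a_in: "a \<in> ?A" for a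
  proof (cases a)
    case (Inl p)
    obtain j \<gamma> where p: "p = (j, \<gamma>)" by fastforce
    have j: "j \<in> {1..n}" "d j \<le> e" "\<gamma> \<in> exps {1..n} (e - d j)"
      using a_in assms by (auto simp: Inl p box_multiples_def box_def)
    show ?thesis
      using family_mult[OF _ family_mono_of[OF j(3)] family_general_form[OF j(1)]] j(2)
      by (simp add: Inl p v_def [abs_def])
  next
    case (Inr \<gamma>)
    then have "\<gamma> \<in> exps {1..n} e" using a_in by (auto simp: box_def)
    then show ?thesis by (simp add: Inr v_def [abs_def] family_mono_of)
  qed
  ultimately obtain D where
      "D \<in> coefficient_functions F (SIGMA j:{1..n}. exps {1..n} (d j))" "D c0 \<noteq> 0"
      "\<And>b. D b \<noteq> 0 \<Longrightarrow> forms {1..n} e \<subseteq> vs.span ((\<lambda>a. v a b) ` ?A)"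
    using spanning_open[of "{1..n}" ?A e v c0] by blast
  then show ?thesis
    using generic_nonzero[OF generic] unfolding im box_spanning_def by metis
qed

text \<open>
  Specialise the generic forms to products of linear forms, one block of labels for each form.
\<close>

lemma generic_lefschetz:
  assumes "infinite (UNIV :: 'k set)" "1 \<le> n" "(\<Sum>j=1..n. d j) + m \<le> 2 * e + n"
  shows "forms {1..n} e \<subseteq> idl.span (insert (var n ^ m) ((\<lambda>j. general_form j c) ` {1..n}))"
proof -
  define block where "block j = {j} \<times> {..<d j}" for j
  let ?Ds = "map block [1..<Suc n]"
  have set: "set [1..<Suc n] = {1..n}" by auto
  have "\<exists>L :: nat \<times> nat \<Rightarrow> 'k mpoly. (\<forall>k. L k \<in> forms {1..n} 1) \<and>
      forms {1..n} e \<subseteq> idl.span (prod L ` set ?Ds \<union> {var n ^ m})"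
  proof (rule exists_lefschetz_products[OF assms(1)])
    show "sorted_wrt (\<lambda>A B. A \<inter> B = {}) ?Ds"
      unfolding sorted_wrt_map
      by (rule sorted_wrt_mono_rel[OF _ sorted_wrt_upt]) (auto simp: block_def)
    have "sum_list (map card ?Ds) = (\<Sum>j\<leftarrow>[1..<Suc n]. d j)"
      by (simp add: block_def comp_def)
    also have "\<dots> = (\<Sum>j=1..n. d j)"
      by (subst sum_list_distinct_conv_sum_set) (simp_all only: distinct_upt set)
    finally show "sum_list (map card ?Ds) + m \<le> 2 * e + card {1..n}" using assms(3) by simp
  qed (use assms(2) in \<open>auto simp: block_def\<close>)
  then obtain L :: "nat \<times> nat \<Rightarrow> 'k mpoly" where L: "\<And>k. L k \<in> forms {1..n} 1"
      "forms {1..n} e \<subseteq> idl.span (prod L ` set ?Ds \<union> {var n ^ m})"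
    by blast
  have gens: "prod L ` set ?Ds \<union> {var n ^ m} =
      insert (mono_of (Poly_Mapping.single n m)) ((\<lambda>j. prod L (block j)) ` {1..n})"
    by (simp only: set_map set image_image var_power Un_insert_right Un_empty_right)
  have "prod L (block j) \<in> forms {1..n} (d j)" for j
    using forms_prod[of "block j" L "{1..n}"] L(1) by (simp add: block_def)
  moreover have "Poly_Mapping.single n m \<in> exps {1..n} m"
    using assms(2) by (auto simp: exps_def)
  ultimately show ?thesis
    using generic_ideal_contains_forms[of "\<lambda>j. prod L (block j)" "Poly_Mapping.single n m" m e] L(2)[unfolded gens]
    unfolding var_power by blast
qed

end

section \<open>The symmetry of the standard monomials\<close>

theorem lemma3p4:
  fixes F :: "'k::field set"
    and J :: "((nat \<Rightarrow>\<^sub>0 nat) \<Rightarrow>\<^sub>0 'k) set"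
    and d :: "nat \<Rightarrow> nat"
    and n \<delta> i :: nat
  assumes "infinite (UNIV :: 'k set)"
    and "is_subfield F"
    and "1 \<le> n"
    and "generic_ideal F n d J"
    and "\<delta> = (\<Sum>k = 1..n. d k) - n"
    and "2 * i \<le> \<delta>"
  shows "standard_monomials n J (\<delta> - i) =
    (\<lambda>m. var n ^ (\<delta> - 2 * i) * m) ` standard_monomials n J i"
proof -
  obtain c where c: "alg_independent F (SIGMA j:{1..n}. exps {1..n} (d j)) c"
      "J = ideal_gen n ((\<lambda>j. \<Sum>\<alpha>\<in>exps {1..n} (d j). Poly_Mapping.single \<alpha> (c (j, \<alpha>))) ` {1..n})"
    using assms(4) unfolding generic_ideal_def exponents_eq_exps by blast
  have d: "1 \<le> d j" if "j \<in> {1..n}" for j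
    using assms(4) that unfolding generic_ideal_def by blast
  interpret generic_forms F n d c by unfold_locales (fact assms(2), fact c(1))
  define f where "f = (\<lambda>j. general_form j c)"
  have J: "J = ideal_gen n (f ` {1..n})" unfolding c(2) f_def general_form_def ..
  have f: "f j \<in> forms {1..n} (d j)" if "j \<in> {1..n}" for j
    using family_general_form[OF that] by (simp add: family_def f_def)
  interpret J: homogeneous_ideal n J
    unfolding J using f by (rule homogeneous_ideal_gen(1))
  have in_J: "p \<in> J \<longleftrightarrow> p \<in> idl.span (f ` {1..n})" if "p \<in> forms {1..n} e" for p e
    unfolding J using f that by (rule homogeneous_ideal_gen(2))
  define m where "m = \<delta> - 2 * i"
  define z where "z = Poly_Mapping.single n m"
  have z: "z \<in> exps {1..n} m" using assms(3) by (auto simp: z_def exps_def)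
  let ?std = "standard_exps n J"
  have "(\<Sum>j\<in>{1..n}. 1) \<le> (\<Sum>j\<in>{1..n}. d j)" using d by (intro sum_mono)
  then have deg: "(\<Sum>j=1..n. d j) = \<delta> + n" using assms(5) by simp
  have "forms {1..n} (\<delta> - i) \<subseteq> idl.span (insert (var n ^ m) (f ` {1..n}))"
    unfolding f_def using assms(6) deg by (intro generic_lefschetz assms) (simp add: m_def)
  then have lefschetz: "forms {1..n} (\<delta> - i) \<subseteq> idl.span (insert (mono_of z) (f ` {1..n}))"
    by (simp only: var_power z_def)
  have split: "\<exists>r\<in>forms {1..n} (\<delta> - i). p - r \<in> J \<and> (\<forall>\<beta>\<in>supp r. m \<le> coef \<beta> n)"
    if p: "p \<in> forms {1..n} (\<delta> - i)" for p
  proof -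
    have "homogeneous {1..n} (f ` {1..n})" using f unfolding homogeneous_def by blast
    then obtain q where q: "p - q * mono_of z \<in> idl.span (f ` {1..n})"
        "q = 0 \<or> m \<le> \<delta> - i \<and> q \<in> forms {1..n} (\<delta> - i - m)"
      using form_in_ideal_insert[of "{1..n}" "f ` {1..n}" "mono_of z" m p "\<delta> - i"] z p lefschetz
      by auto
    have r: "q * mono_of z \<in> forms {1..n} (\<delta> - i)"
    proof (cases "q = 0")
      case False
      have "\<delta> - i = \<delta> - i - m + m" using assms(6) by (simp add: m_def)
      moreover have "q * mono_of z \<in> forms {1..n} (\<delta> - i - m + m)"
        using False q(2) z by (intro forms_mult) simp_all
      ultimately show ?thesis by simp
    qed (simp add: forms_zero)
    have "m \<le> coef \<beta> n" if "\<beta> \<in> supp (q * mono_of z)" for \<beta>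
      using that supp_single_mult[of z 1 q] by (auto simp: mono_of_def mult.commute lookup_add z_def)
    then show ?thesis
      using q(1) r in_J[OF forms_diff[OF p r]] by blast
  qed
  have "?std (\<delta> - i) \<subseteq> (+) z ` ?std i"
  proof
    fix \<alpha> assume \<alpha>: "\<alpha> \<in> ?std (\<delta> - i)"
    then have "m \<le> coef \<alpha> n" using J.standard_divisible_by_last[OF split] by blast
    then have eq: "\<alpha> = z + (\<alpha> - z)"
      by (intro poly_mapping_eqI) (auto simp: z_def lookup_add lookup_minus lookup_single when_def)
    have "\<delta> - i - mdeg z = i" using assms(6) by (simp add: z_def m_def)
    then have "\<alpha> - z \<in> ?std i" using J.standard_exps_divisor[of z "\<alpha> - z" "\<delta> - i"] \<alpha> eq by simp
    with eq show "\<alpha> \<in> (+) z ` ?std i" by blast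
  qed
  moreover have "card ((+) z ` ?std i) \<le> card (?std (\<delta> - i))"
  proof -
    have card: "card (?std e) = card (box n d n e)" for e
      unfolding J
    proof (rule card_standard_exps_eq_box)
      show "f j \<in> forms {1..n} (d j)" if "j \<in> {1..n}" for j
        using that by (rule f)
      show "box_spanning n d f k e" if "k \<le> n" for k e
        unfolding f_def using that by (rule generic_box_spanning)
    qed
    have "card ((+) z ` ?std i) = card (?std i)" by (intro card_image) simp
    also have "\<dots> \<le> card (?std (\<delta> - i))"
      unfolding card assms(5) using d assms(5,6) by (intro card_box_symmetric) auto
    finally show ?thesis .
  qed
  ultimately have "?std (\<delta> - i) = (+) z ` ?std i"
    by (intro card_seteq) (simp_all add: finite_standard_exps)
  then show ?thesis
    by (simp add: standard_monomials_eq image_image var_power mono_of_mult z_def m_def)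
qed

end
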